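(* Let $(\Omega,\mathscr{F},P)$ be a probability space, $(E,\rho)$ a complete metric space and $X:[0,\infty)\times E\to L^0(\Omega,E)$ a continuous map. Define $T(t)f(x)=\mathbb{E}(f(X(t,x)))$ for $f\in C_b(E)$, $t\ge0$, $x\in E$. Then, for every $t_0>0$, the set $\{T(t):0\le t\le t_0\}$ is a $\beta_0$-equicontinuous family of operators on $(C_b(E),\mathcal{M}_0(E))$. If $(T(t))_{t\ge0}$ is a semigroup, then it is $\beta_0$-continuous and quasi-$\beta_0$-equicontinuous.
   Context: $L^0(\Omega,E)$ is the space of all strongly measurable maps $\Omega\to E$ (modulo equality $P$-almost everywhere) with the topology of convergence in measure; $\mathbb{E}$ is expectation with respect to $P$. $C_b(E)$ is the Banach space of bounded continuous functions $E\to\mathbb{C}$ with the supremum norm. A positive measure $\mu$ on the Borel $\sigma$-algebra $\mathcal{B}(E)$ is Radon if $\mu(A)=\sup\{\mu(K):K\subset A,\ K\text{ compact}\}$ for all $A\in\mathcal{B}(E)$; a complex measure is Radon if its total variation is. $\mathcal{M}_0(E)$ is the Banach space of bounded complex Radon measures with the total variation norm; the duality is $\langle f,\mu\rangle=\int_E f\,d\mu$, and $\sigma=\sigma(C_b(E),\mathcal{M}_0(E))$ is the associated weak topology. An operator on the pair $(C_b(E),\mathcal{M}_0(E))$ is an element of $L(C_b(E),\sigma)$, where $L(C_b(E),\tau)$ denotes the $\tau$-continuous linear operators on $C_b(E)$. The strict topology $\beta_0$ on $C_b(E)$ is the locally convex topology generated by the seminorms $f\mapsto\|\varphi f\|_\infty$,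 where $\varphi$ ranges over all bounded functions on $E$ vanishing at infinity (for every $\varepsilon>0$ there is a compact $K\subset E$ with $|\varphi(x)|\le\varepsilon$ for $x\notin K$). A set $\mathcal{S}\subset L(C_b(E),\beta_0)$ is $\beta_0$-equicontinuous if for every $\beta_0$-continuous seminorm $p$ there is a $\beta_0$-continuous seminorm $q$ with $p(Tf)\le q(f)$ for all $f\in C_b(E)$, $T\in\mathcal{S}$. "$(T(t))_{t\ge0}$ is a semigroup" means $T(0)=I$ and $T(t+s)=T(t)T(s)$ for all $t,s\ge0$. A semigroup is $\beta_0$-continuous if $t\mapsto T(t)f$ is $\beta_0$-continuous on $[0,\infty)$ for every $f$, and quasi-$\beta_0$-equicontinuous if for some $\alpha\in\mathbb{R}$ the set $\{e^{-\alpha t}T(t):t\ge0\}$ is $\beta_0$-equicontinuous. *)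

theory Defs
  imports "HOL-Probability.Probability"
begin

section \<open>Random elements and convergence in measure\<close>

text \<open>Unlike Borel measurability, this notion forces a separable range, also when the metric
  space itself is not separable. Elements of \<open>L\<^sup>0\<close> are handled through representatives: every
  class modulo almost everywhere equality contains a function as below, and the topology of
  convergence in measure does not distinguish functions that agree almost everywhere.\<close>

definition strongly_measurable :: "'w measure \<Rightarrow> ('w \<Rightarrow> 'a::metric_space) \<Rightarrow> bool" where
  "strongly_measurable M f \<longleftrightarrow>
     (\<exists>s. (\<forall>n::nat. simple_function M (s n)) \<and> (\<forall>\<omega>\<in>space M. (\<lambda>n. s n \<omega>) \<longlonglongrightarrow> f \<omega>))"

definition L0 :: "'w measure \<Rightarrow> ('w \<Rightarrow> 'a::metric_space) set" where
  "L0 M = {f. strongly_measurable M f}"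

definition L0_nbhd ::
  "'w measure \<Rightarrow> ('w \<Rightarrow> 'a::metric_space) \<Rightarrow> real \<Rightarrow> real \<Rightarrow> ('w \<Rightarrow> 'a) set" where
  "L0_nbhd M f \<epsilon> \<delta> =
     {g \<in> L0 M. emeasure M {\<omega> \<in> space M. dist (f \<omega>) (g \<omega>) > \<epsilon>} < ennreal \<delta>}"

definition L0_topology :: "'w measure \<Rightarrow> ('w \<Rightarrow> 'a::metric_space) topology" where
  "L0_topology M = topology (\<lambda>U. U \<subseteq> L0 M \<and> (\<forall>f\<in>U. \<exists>\<epsilon>>0. \<exists>\<delta>>0. L0_nbhd M f \<epsilon> \<delta> \<subseteq> U))"

lemma L0_dist_measurable:
  assumes "f \<in> L0 M" "g \<in> L0 M"
  shows "(\<lambda>\<omega>. dist (f \<omega>) (g \<omega>)) \<in> borel_measurable M"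
proof -
  obtain s where s: "\<And>n::nat. simple_function M (s n)"
      "\<And>\<omega>. \<omega> \<in> space M \<Longrightarrow> (\<lambda>n. s n \<omega>) \<longlonglongrightarrow> f \<omega>"
    using assms(1) by (auto simp: L0_def strongly_measurable_def)
  obtain t where t: "\<And>n::nat. simple_function M (t n)"
      "\<And>\<omega>. \<omega> \<in> space M \<Longrightarrow> (\<lambda>n. t n \<omega>) \<longlonglongrightarrow> g \<omega>"
    using assms(2) by (auto simp: L0_def strongly_measurable_def)
  show ?thesis
  proof (rule borel_measurable_LIMSEQ_real)
    show "(\<lambda>\<omega>. dist (s n \<omega>) (t n \<omega>)) \<in> borel_measurable M" for n
      by (rule borel_measurable_simple_function)
         (rule simple_function_compose2[OF s(1) t(1), of dist])
    show "(\<lambda>n. dist (s n \<omega>) (t n \<omega>)) \<longlonglongrightarrow> dist (f \<omega>) (g \<omega>)"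
      if "\<omega> \<in> space M" for \<omega>
      using that by (intro tendsto_dist s(2) t(2))
  qed
qed

lemma L0_nbhd_mono:
  assumes "f \<in> L0 M" "\<epsilon> \<le> \<epsilon>'" "\<delta> \<le> \<delta>'"
  shows "L0_nbhd M f \<epsilon> \<delta> \<subseteq> L0_nbhd M f \<epsilon>' \<delta>'"
proof
  fix g assume g: "g \<in> L0_nbhd M f \<epsilon> \<delta>"
  then have gL: "g \<in> L0 M" by (simp add: L0_nbhd_def)
  note [measurable] = L0_dist_measurable[OF assms(1) gL]
  have "emeasure M {\<omega> \<in> space M. dist (f \<omega>) (g \<omega>) > \<epsilon>'}
      \<le> emeasure M {\<omega> \<in> space M. dist (f \<omega>) (g \<omega>) > \<epsilon>}"
    using assms(2) by (intro emeasure_mono) auto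
  also have "\<dots> < ennreal \<delta>" using g by (simp add: L0_nbhd_def)
  also have "\<dots> \<le> ennreal \<delta>'" using assms(3) by (rule ennreal_leI)
  finally show "g \<in> L0_nbhd M f \<epsilon>' \<delta>'" using gL by (simp add: L0_nbhd_def)
qed

lemma openin_L0_topology:
  fixes M :: "'w measure" and U :: "('w \<Rightarrow> 'a::metric_space) set"
  shows "openin (L0_topology M) U \<longleftrightarrow>
     U \<subseteq> L0 M \<and> (\<forall>f\<in>U. \<exists>\<epsilon>>0. \<exists>\<delta>>0. L0_nbhd M f \<epsilon> \<delta> \<subseteq> U)"
proof -
  have "istopology (\<lambda>U :: ('w \<Rightarrow> 'a) set. U \<subseteq> L0 M \<and> (\<forall>f\<in>U. \<exists>\<epsilon>>0. \<exists>\<delta>>0. L0_nbhd M f \<epsilon> \<delta> \<subseteq> U))"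
    unfolding istopology_def
  proof (intro conjI allI impI)
    fix S T :: "('w \<Rightarrow> 'a) set"
    assume S: "S \<subseteq> L0 M \<and> (\<forall>f\<in>S. \<exists>\<epsilon>>0. \<exists>\<delta>>0. L0_nbhd M f \<epsilon> \<delta> \<subseteq> S)"
      and T: "T \<subseteq> L0 M \<and> (\<forall>f\<in>T. \<exists>\<epsilon>>0. \<exists>\<delta>>0. L0_nbhd M f \<epsilon> \<delta> \<subseteq> T)"
    show "S \<inter> T \<subseteq> L0 M" using S by blast
    show "\<forall>f\<in>S \<inter> T. \<exists>\<epsilon>>0. \<exists>\<delta>>0. L0_nbhd M f \<epsilon> \<delta> \<subseteq> S \<inter> T"
    proof
      fix f assume f: "f \<in> S \<inter> T"
      then have fL: "f \<in> L0 M" using S by blast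
      obtain a b where ab: "a > 0" "b > 0" "L0_nbhd M f a b \<subseteq> S" using S f by blast
      obtain c d where cd: "c > 0" "d > 0" "L0_nbhd M f c d \<subseteq> T" using T f by blast
      have "L0_nbhd M f (min a c) (min b d) \<subseteq> S \<inter> T"
        using L0_nbhd_mono[OF fL, of "min a c" a "min b d" b]
          L0_nbhd_mono[OF fL, of "min a c" c "min b d" d] ab cd by auto
      then show "\<exists>\<epsilon>>0. \<exists>\<delta>>0. L0_nbhd M f \<epsilon> \<delta> \<subseteq> S \<inter> T"
        using ab cd by (metis min_less_iff_conj)
    qed
  next
    fix \<K>
    assume K: "\<forall>S\<in>\<K>. S \<subseteq> L0 M \<and> (\<forall>f\<in>S. \<exists>\<epsilon>>0. \<exists>\<delta>>0. L0_nbhd M f \<epsilon> \<delta> \<subseteq> S)"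
    show "\<Union>\<K> \<subseteq> L0 M" using K by blast
    show "\<forall>f\<in>\<Union>\<K>. \<exists>\<epsilon>>0. \<exists>\<delta>>0. L0_nbhd M f \<epsilon> \<delta> \<subseteq> \<Union>\<K>"
    proof
      fix f assume "f \<in> \<Union>\<K>"
      then obtain S where S: "S \<in> \<K>" "f \<in> S" by blast
      then obtain a b where "a > 0" "b > 0" "L0_nbhd M f a b \<subseteq> S" using K by blast
      then show "\<exists>\<epsilon>>0. \<exists>\<delta>>0. L0_nbhd M f \<epsilon> \<delta> \<subseteq> \<Union>\<K>" using S by blast
    qed
  qed
  then show ?thesis by (simp add: L0_topology_def)
qed

lemma topspace_L0_topology [simp]: "topspace (L0_topology M) = L0 M"
proof (rule antisym)
  show "topspace (L0_topology M) \<subseteq> L0 M"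
    using openin_topspace[of "L0_topology M"] unfolding openin_L0_topology by blast
  have "openin (L0_topology M) (L0 M)"
    unfolding openin_L0_topology by (auto simp: L0_nbhd_def intro: zero_less_one)
  then show "L0 M \<subseteq> topspace (L0_topology M)" by (rule openin_subset)
qed


section \<open>The pair of bounded continuous functions and Radon measures\<close>

abbreviation Cb :: "('a::metric_space \<Rightarrow> complex) set" where
  "Cb \<equiv> bcontfun"

definition complex_measure :: "('a::metric_space set \<Rightarrow> complex) \<Rightarrow> bool" where
  "complex_measure \<mu> \<longleftrightarrow>
     (\<forall>A::nat \<Rightarrow> 'a set. range A \<subseteq> sets borel \<longrightarrow> disjoint_family A \<longrightarrow>
        (\<lambda>n. \<mu> (A n)) sums \<mu> (\<Union>n. A n))"

definition total_variation :: "('a::metric_space set \<Rightarrow> complex) \<Rightarrow> 'a set \<Rightarrow> ennreal" where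
  "total_variation \<mu> A =
     (SUP \<P>\<in>{\<P>. finite \<P> \<and> disjoint \<P> \<and> \<P> \<subseteq> sets borel \<and> \<Union>\<P> = A}.
        \<Sum>B\<in>\<P>. ennreal (cmod (\<mu> B)))"

definition radon :: "('a::metric_space set \<Rightarrow> ennreal) \<Rightarrow> bool" where
  "radon \<nu> \<longleftrightarrow> (\<forall>A\<in>sets borel. \<nu> A = (SUP K\<in>{K. compact K \<and> K \<subseteq> A}. \<nu> K))"

definition M0 :: "('a::metric_space set \<Rightarrow> complex) set" where
  "M0 = {\<mu>. complex_measure \<mu> \<and> total_variation \<mu> UNIV < \<infinity> \<and> radon (total_variation \<mu>)}"

text \<open>The upper variation of a real-valued measure, i.e. the positive part in its Jordan
  decomposition. The negative part of \<open>\<nu>\<close> is the upper variation of \<open>-\<nu>\<close>. Integration with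
  respect to a complex measure is reduced to the Jordan decompositions of its real and imaginary
  parts.\<close>

definition upper_variation :: "('a::metric_space set \<Rightarrow> real) \<Rightarrow> 'a measure" where
  "upper_variation \<nu> =
     measure_of UNIV (sets borel) (\<lambda>A. SUP B\<in>{B. B \<in> sets borel \<and> B \<subseteq> A}. ennreal (\<nu> B))"

definition signed_integral :: "('a::metric_space set \<Rightarrow> real) \<Rightarrow> ('a \<Rightarrow> complex) \<Rightarrow> complex" where
  "signed_integral \<nu> f =
     (\<integral>x. f x \<partial>upper_variation \<nu>) - (\<integral>x. f x \<partial>upper_variation (\<lambda>A. - \<nu> A))"

definition pairing :: "('a::metric_space \<Rightarrow> complex) \<Rightarrow> ('a set \<Rightarrow> complex) \<Rightarrow> complex" where
  "pairing f \<mu> =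
     signed_integral (\<lambda>A. Re (\<mu> A)) f + \<i> * signed_integral (\<lambda>A. Im (\<mu> A)) f"

definition weak_topology :: "('a::metric_space \<Rightarrow> complex) topology" where
  "weak_topology =
     topology_generated_by {{f \<in> Cb. pairing f \<mu> \<in> U} | \<mu> U. \<mu> \<in> M0 \<and> open U}"

definition vanishing_at_infinity :: "('a::metric_space \<Rightarrow> complex) \<Rightarrow> bool" where
  "vanishing_at_infinity \<phi> \<longleftrightarrow>
     (\<forall>\<epsilon>>0. \<exists>K. compact K \<and> (\<forall>x. x \<notin> K \<longrightarrow> cmod (\<phi> x) \<le> \<epsilon>))"

text \<open>The weights are arbitrary bounded functions; they need not be continuous.\<close>

definition strict_weights :: "('a::metric_space \<Rightarrow> complex) set" where
  "strict_weights = {\<phi>. bounded (range \<phi>) \<and> vanishing_at_infinity \<phi>}"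

definition weighted_norm ::
  "('a::metric_space \<Rightarrow> complex) \<Rightarrow> ('a \<Rightarrow> complex) \<Rightarrow> real" where
  "weighted_norm \<phi> f = (SUP x. cmod (\<phi> x * f x))"

definition strict_topology :: "('a::metric_space \<Rightarrow> complex) topology" where
  "strict_topology =
     topology_generated_by
       {{g \<in> Cb. weighted_norm \<phi> (\<lambda>x. g x - f x) < r} | \<phi> f r.
          \<phi> \<in> strict_weights \<and> f \<in> Cb \<and> r > 0}"

lemma topspace_weak_topology [simp]: "topspace weak_topology = Cb"
proof -
  have "total_variation (\<lambda>_. 0) = (\<lambda>A :: 'a set. 0)"
    by (simp add: fun_eq_iff total_variation_def SUP_constant bot_ennreal)
  moreover have "{K :: 'a set. compact K \<and> K \<subseteq> A} \<noteq> {}" for A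
    by (auto intro: exI[of _ "{}"])
  ultimately have "(\<lambda>_. 0) \<in> (M0 :: ('a set \<Rightarrow> complex) set)"
    unfolding M0_def by (simp add: complex_measure_def radon_def)
  then have "Cb \<in> {{f \<in> Cb. pairing f \<mu> \<in> U} | (\<mu> :: 'a set \<Rightarrow> complex) U. \<mu> \<in> M0 \<and> open U}"
    by (intro CollectI exI[of _ "\<lambda>_. 0"] exI[of _ UNIV]) auto
  then show ?thesis unfolding weak_topology_def topology_generated_by_topspace by blast
qed

lemma topspace_strict_topology [simp]: "topspace strict_topology = Cb"
proof -
  have 0: "(\<lambda>_. 0) \<in> (strict_weights :: ('a \<Rightarrow> complex) set)"
    by (auto simp: strict_weights_def vanishing_at_infinity_def intro: compact_empty)
  have "Cb \<in> {{g \<in> Cb. weighted_norm \<phi> (\<lambda>x. g x - f x) < r} | (\<phi> :: 'a \<Rightarrow> complex) f r.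
          \<phi> \<in> strict_weights \<and> f \<in> Cb \<and> r > 0}"
    by (intro CollectI exI[of _ "\<lambda>_. 0"] exI[of _ 1])
       (use 0 in \<open>auto simp: weighted_norm_def intro: const_bcontfun\<close>)
  then show ?thesis unfolding strict_topology_def topology_generated_by_topspace by blast
qed


section \<open>Operators and semigroups\<close>

text \<open>Operators are functions on all of \<open>'a \<Rightarrow> complex\<close>, but only their restriction to
  \<open>Cb\<close> is ever constrained.\<close>

definition linear_on_Cb ::
  "(('a::metric_space \<Rightarrow> complex) \<Rightarrow> ('a \<Rightarrow> complex)) \<Rightarrow> bool" where
  "linear_on_Cb T \<longleftrightarrow>
     (\<forall>f\<in>Cb. \<forall>g\<in>Cb. T (\<lambda>x. f x + g x) = (\<lambda>x. T f x + T g x)) \<and>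
     (\<forall>c. \<forall>f\<in>Cb. T (\<lambda>x. c * f x) = (\<lambda>x. c * T f x))"

definition continuous_operators ::
  "('a::metric_space \<Rightarrow> complex) topology \<Rightarrow> (('a \<Rightarrow> complex) \<Rightarrow> ('a \<Rightarrow> complex)) set" where
  "continuous_operators \<tau> = {T. T ` Cb \<subseteq> Cb \<and> linear_on_Cb T \<and> continuous_map \<tau> \<tau> T}"

definition strict_continuous_seminorm ::
  "(('a::metric_space \<Rightarrow> complex) \<Rightarrow> real) \<Rightarrow> bool" where
  "strict_continuous_seminorm p \<longleftrightarrow>
     (\<forall>f\<in>Cb. 0 \<le> p f) \<and>
     (\<forall>f\<in>Cb. \<forall>g\<in>Cb. p (\<lambda>x. f x + g x) \<le> p f + p g) \<and>
     (\<forall>c. \<forall>f\<in>Cb. p (\<lambda>x. c * f x) = cmod c * p f) \<and>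
     continuous_map strict_topology euclideanreal p"

definition strict_equicontinuous ::
  "(('a::metric_space \<Rightarrow> complex) \<Rightarrow> ('a \<Rightarrow> complex)) set \<Rightarrow> bool" where
  "strict_equicontinuous S \<longleftrightarrow>
     S \<subseteq> continuous_operators strict_topology \<and>
     (\<forall>p. strict_continuous_seminorm p \<longrightarrow>
        (\<exists>q. strict_continuous_seminorm q \<and> (\<forall>T\<in>S. \<forall>f\<in>Cb. p (T f) \<le> q f)))"

definition operator_semigroup ::
  "(real \<Rightarrow> ('a::metric_space \<Rightarrow> complex) \<Rightarrow> ('a \<Rightarrow> complex)) \<Rightarrow> bool" where
  "operator_semigroup T \<longleftrightarrow>
     (\<forall>f\<in>Cb. T 0 f = f) \<and>
     (\<forall>t\<ge>0. \<forall>s\<ge>0. \<forall>f\<in>Cb. T (t + s) f = T t (T s f))"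

definition strict_continuous_family ::
  "(real \<Rightarrow> ('a::metric_space \<Rightarrow> complex) \<Rightarrow> ('a \<Rightarrow> complex)) \<Rightarrow> bool" where
  "strict_continuous_family T \<longleftrightarrow>
     (\<forall>f\<in>Cb. continuous_map (top_of_set {0..}) strict_topology (\<lambda>t. T t f))"

definition quasi_strict_equicontinuous ::
  "(real \<Rightarrow> ('a::metric_space \<Rightarrow> complex) \<Rightarrow> ('a \<Rightarrow> complex)) \<Rightarrow> bool" where
  "quasi_strict_equicontinuous T \<longleftrightarrow>
     (\<exists>\<alpha>::real. strict_equicontinuous {\<lambda>f x. exp (- \<alpha> * t) *\<^sub>R T t f x | t. t \<ge> 0})"

definition transition_operator ::
  "'w measure \<Rightarrow> (real \<Rightarrow> 'a::metric_space \<Rightarrow> 'w \<Rightarrow> 'a) \<Rightarrow>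
     real \<Rightarrow> ('a \<Rightarrow> complex) \<Rightarrow> ('a \<Rightarrow> complex)" where
  "transition_operator M X t f = (\<lambda>x. \<integral>\<omega>. f (X t x \<omega>) \<partial>M)"

end

theory Submission
  imports Defs
begin

text \<open>
  Integrating a bounded continuous function is continuous on \<open>L0\<close>, so \<open>(t, x) \<mapsto> T t f x\<close> is
  jointly continuous. Applied to truncated distances from finite sets, this makes the laws of
  \<open>X t x\<close> uniformly tight over compact sets of \<open>(t, x)\<close>; completeness of the space enters here.
  For a weight \<open>\<phi>\<close> and a scalar factor \<open>w\<close> with \<open>w t \<longlongrightarrow> 0\<close> at infinity, the measures
  \<open>w t * \<phi> x * law (X t x)\<close> then form a bounded tight family, and any such family is dominated by
  a single weighted norm. Taking \<open>w\<close> to be the indicator of \<open>[0, t0]\<close> gives the local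
  equicontinuity, and \<open>w t = exp (- t)\<close> gives the quasi-equicontinuity.
\<close>

section \<open>Tightness of continuous random fields\<close>

text \<open>\<open>E\<close> need not be separable, so Borel measurability alone does not make a law
  tight. Strong measurability does: simple functions have finite range, so each law is nearly
  carried by small neighbourhoods of a finite set, and joint continuity spreads this over compact
  sets of \<open>(t, x)\<close>. The set of times is not compact either; the decay of
  \<open>w\<close> repairs this, because outside a box \<open>{0..s} \<times> L\<close> either
  \<open>w t\<close> or \<open>\<phi> x\<close> is small.

  Continuity for \<open>weak_topology\<close> is a separate matter, settled by duality: for each
  \<open>\<mu>\<close> in \<open>M0\<close> the functional
  \<open>f \<mapsto> pairing (T t f) \<mu>\<close> has to be the pairing with another element of
  \<open>M0\<close>. Since elements of \<open>M0\<close> are set functions and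
  \<open>pairing\<close> integrates against Jordan parts, these parts are first shown to be finite
  tight measures, then moved by the transition kernel, and finally reassembled. The result is
  usually not given in its Jordan decomposition, so the integral must be shown not to depend on how
  a signed measure is written as a difference of finite measures.\<close>

lemma L0_borel_measurable:
  assumes "f \<in> L0 M"
  shows "f \<in> borel_measurable M"
proof -
  obtain s where s: "\<And>n::nat. simple_function M (s n)"
      "\<And>\<omega>. \<omega> \<in> space M \<Longrightarrow> (\<lambda>n. s n \<omega>) \<longlonglongrightarrow> f \<omega>"
    using assms by (auto simp: L0_def strongly_measurable_def)
  show ?thesis
    by (rule borel_measurable_LIMSEQ_metric[OF borel_measurable_simple_function[OF s(1)] s(2)])
qed

lemma bcontfun_borel_measurable:
  "f \<in> bcontfun \<Longrightarrow> f \<in> borel_measurable borel"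
  by (auto simp: bcontfun_def intro: borel_measurable_continuous_onI)

lemma bcontfun_normE:
  fixes f :: "'a::topological_space \<Rightarrow> 'b::real_normed_vector"
  assumes "f \<in> bcontfun"
  obtains B where "B > 0" "\<And>x. norm (f x) \<le> B"
proof -
  obtain B where "\<And>x. norm (f x) \<le> B"
    using assms by (auto simp: bcontfun_def bounded_iff)
  then show thesis
    by (intro that[of "max B 1"]) (auto simp: le_max_iff_disj)
qed

section \<open>Expectations as continuous functionals of random elements\<close>

lemma (in prob_space) integrable_bcontfun_L0:
  fixes f :: "'e::metric_space \<Rightarrow> 'b::{banach, second_countable_topology}"
  assumes "f \<in> bcontfun" "Y \<in> L0 M"
  shows "integrable M (\<lambda>\<omega>. f (Y \<omega>))"
proof -
  obtain B where "\<And>x. norm (f x) \<le> B" using bcontfun_normE[OF assms(1)] by blast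
  then show ?thesis
    using bcontfun_borel_measurable[OF assms(1)] L0_borel_measurable[OF assms(2)]
    by (intro integrable_const_bound[of _ B]) auto
qed

text \<open>As \<open>f\<close> is not uniformly continuous, closeness of \<open>Z\<close> to
  \<open>Y\<close> does not bound \<open>f (Z \<omega>) - f (Y \<omega>)\<close> uniformly. Two rare
  events are removed: \<open>Y\<close> visits a point where \<open>f\<close> oscillates at the given
  scale, or \<open>Z\<close> is far from \<open>Y\<close>. There the crude bound
  \<open>2 * B\<close> suffices; elsewhere the difference is at most \<open>d\<close>.\<close>

lemma (in prob_space) expectation_L0_nbhd:
  fixes f :: "'e::metric_space \<Rightarrow> 'b::{banach, second_countable_topology}"
  assumes f: "f \<in> bcontfun" and Y: "Y \<in> L0 M" and e: "e > 0"
  obtains a b where "a > 0" "b > 0"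
    "\<And>Z. Z \<in> L0_nbhd M Y a b \<Longrightarrow> dist (\<integral>\<omega>. f (Z \<omega>) \<partial>M) (\<integral>\<omega>. f (Y \<omega>) \<partial>M) < e"
proof -
  obtain B where B: "B > 0" "\<And>x. norm (f x) \<le> B" using bcontfun_normE[OF f] by blast
  \<comment> \<open>The final bound is \<open>d + 2 * B * (d + d) = d * (1 + 4 * B)\<close>, which
    this choice makes \<open>e / 2\<close>.\<close>
  define d where "d = e / (2 * (1 + 4 * B))"
  have d: "d > 0" using B e by (simp add: d_def)
  have cf: "continuous_on UNIV f" using f by (simp add: bcontfun_def)
  note [measurable] = L0_borel_measurable[OF Y] bcontfun_borel_measurable[OF f]
  \<comment> \<open>The points near which \<open>f\<close> oscillates by more than \<open>d\<close> at scale \<open>1 / (n + 1)\<close>; these open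
    sets decrease to the empty set, so \<open>Y\<close> rarely visits them for large \<open>n\<close>.\<close>
  define A where "A n = {y. \<exists>z. dist y z < 1 / real (Suc n) \<and> dist (f y) (f z) > d}" for n
  have "open (A n)" for n
  proof -
    have "A n = (\<Union>z. {y. dist y z < 1 / real (Suc n)} \<inter> {y. d < dist (f y) (f z)})"
      by (auto simp: A_def)
    moreover have "open {y. dist y z < 1 / real (Suc n)}" for z
      by (intro open_Collect_less continuous_intros)
    moreover have "open {y. d < dist (f y) (f z)}" for z
      by (intro open_Collect_less continuous_intros cf)
    ultimately show ?thesis by (auto intro!: open_UN open_Int simp del: of_nat_Suc)
  qed
  then have [measurable]: "A n \<in> sets borel" for n by simp
  have "(\<lambda>n. prob {\<omega>\<in>space M. Y \<omega> \<in> A n}) \<longlonglongrightarrow> prob (\<Inter>n. {\<omega>\<in>space M. Y \<omega> \<in> A n})"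
  proof (rule finite_Lim_measure_decseq)
    show "decseq (\<lambda>n. {\<omega>\<in>space M. Y \<omega> \<in> A n})"
    proof (rule decseq_SucI, clarify)
      fix n \<omega> assume "Y \<omega> \<in> A (Suc n)"
      moreover have "1 / real (Suc (Suc n)) \<le> 1 / real (Suc n)" by (simp add: frac_le)
      ultimately show "Y \<omega> \<in> A n" unfolding A_def by (blast intro: less_le_trans)
    qed
  qed auto
  moreover have "y \<notin> (\<Inter>n. A n)" for y
  proof
    assume y: "y \<in> (\<Inter>n. A n)"
    obtain r where r: "r > 0" "\<And>z. dist z y < r \<Longrightarrow> dist (f z) (f y) < d"
      using cf d by (metis continuous_on_iff iso_tuple_UNIV_I)
    obtain n where "1 / real (Suc n) < r" using nat_approx_posE[OF r(1)] by blast
    moreover obtain z where "dist y z < 1 / real (Suc n)" "dist (f y) (f z) > d"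
      using y unfolding A_def by blast
    ultimately show False using r(2)[of z] by (simp add: dist_commute)
  qed
  then have "(\<Inter>n. {\<omega>\<in>space M. Y \<omega> \<in> A n}) = {}" by auto
  ultimately have "(\<lambda>n. prob {\<omega>\<in>space M. Y \<omega> \<in> A n}) \<longlonglongrightarrow> 0" by simp
  then obtain n where n: "prob {\<omega>\<in>space M. Y \<omega> \<in> A n} < d"
    using order_tendstoD(2)[OF _ d] by (metis (lifting) eventually_sequentially order_refl)
  \<comment> \<open>Halving turns the non-strict
    \<open>dist (Y \<omega>) (Z \<omega>) \<le> a\<close> off \<open>?R\<close> into the strict
    inequality required in \<open>A n\<close>.\<close>
  define a where "a = 1 / real (Suc n) / 2"
  have a: "a > 0" "a < 1 / real (Suc n)" by (auto simp: a_def divide_simps)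
  show thesis
  proof (rule that[OF a(1) d])
    fix Z assume Z: "Z \<in> L0_nbhd M Y a d"
    then have ZL: "Z \<in> L0 M" by (simp add: L0_nbhd_def)
    note [measurable] = L0_borel_measurable[OF ZL] L0_dist_measurable[OF Y ZL]
    have pZ: "prob {\<omega>\<in>space M. dist (Y \<omega>) (Z \<omega>) > a} < d"
      using Z d by (simp add: L0_nbhd_def emeasure_eq_measure ennreal_less_iff)
    note int = integrable_bcontfun_L0[OF f Y] integrable_bcontfun_L0[OF f ZL]
    let ?S = "{\<omega>\<in>space M. Y \<omega> \<in> A n}" and ?R = "{\<omega>\<in>space M. dist (Y \<omega>) (Z \<omega>) > a}"
    have pt: "norm (f (Z \<omega>) - f (Y \<omega>)) \<le> d + 2 * B * (indicator ?S \<omega> + indicator ?R \<omega>)"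
      if "\<omega> \<in> space M" for \<omega>
    proof (cases "\<omega> \<in> ?S \<union> ?R")
      case True
      have "norm (f (Z \<omega>) - f (Y \<omega>)) \<le> 2 * B"
        using norm_triangle_ineq4[of "f (Z \<omega>)" "f (Y \<omega>)"] B(2)[of "Z \<omega>"] B(2)[of "Y \<omega>"] by linarith
      moreover have "2 * B \<le> 2 * B * (indicator ?S \<omega> + indicator ?R \<omega>)"
        using True B(1) by (auto simp: indicator_def)
      ultimately show ?thesis using d by linarith
    next
      case False
      then have "dist (Y \<omega>) (Z \<omega>) < 1 / real (Suc n)" "Y \<omega> \<notin> A n" using that a by auto
      then have "dist (f (Y \<omega>)) (f (Z \<omega>)) \<le> d" unfolding A_def by force
      then show ?thesis using False B(1) by (auto simp: indicator_def dist_norm norm_minus_commute)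
    qed
    have ind: "integrable M (indicator ?S :: _ \<Rightarrow> real)" "integrable M (indicator ?R :: _ \<Rightarrow> real)"
      by (intro integrable_real_indicator; simp add: emeasure_eq_measure)+
    have "norm (\<integral>\<omega>. f (Z \<omega>) - f (Y \<omega>) \<partial>M)
        \<le> (\<integral>\<omega>. d + 2 * B * (indicator ?S \<omega> + indicator ?R \<omega>) \<partial>M)"
    proof (rule order_trans[OF integral_norm_bound integral_mono])
      show "integrable M (\<lambda>\<omega>. norm (f (Z \<omega>) - f (Y \<omega>)))"
        using int by (intro integrable_norm Bochner_Integration.integrable_diff)
      show "integrable M (\<lambda>\<omega>. d + 2 * B * (indicator ?S \<omega> + indicator ?R \<omega>))"
        using ind by (intro integrable_mult_right Bochner_Integration.integrable_add) auto
    qed (use pt in auto)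
    also have "\<dots> = d + 2 * B * (prob ?S + prob ?R)"
      using ind by (simp add: prob_space)
    also have "\<dots> < d + 2 * B * (d + d)"
      using n pZ B(1) by (intro add_strict_left_mono mult_strict_left_mono add_strict_mono) auto
    also have "\<dots> = d * (1 + 4 * B)" by (simp add: algebra_simps)
    also have "\<dots> = e / 2" using B(1) by (simp add: d_def divide_simps)
    also have "\<dots> < e" using e by simp
    finally show "dist (\<integral>\<omega>. f (Z \<omega>) \<partial>M) (\<integral>\<omega>. f (Y \<omega>) \<partial>M) < e"
      using int by (simp add: dist_norm)
  qed
qed

lemma (in prob_space) continuous_map_expectation_L0:
  fixes f :: "'e::metric_space \<Rightarrow> 'b::{banach, second_countable_topology}"
  assumes f: "f \<in> bcontfun"
  shows "continuous_map (L0_topology M) euclidean (\<lambda>Y. \<integral>\<omega>. f (Y \<omega>) \<partial>M)"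
  unfolding continuous_map openin_L0_topology topspace_L0_topology
proof (intro conjI allI impI ballI)
  fix U :: "'b set" and Y assume U: "openin euclidean U"
    and Y: "Y \<in> {Y \<in> L0 M. (\<integral>\<omega>. f (Y \<omega>) \<partial>M) \<in> U}"
  then obtain e where e: "e > 0" "\<And>y. dist y (\<integral>\<omega>. f (Y \<omega>) \<partial>M) < e \<Longrightarrow> y \<in> U"
    by (auto simp: open_dist)
  obtain a b where "a > 0" "b > 0"
    "\<And>Z. Z \<in> L0_nbhd M Y a b \<Longrightarrow> dist (\<integral>\<omega>. f (Z \<omega>) \<partial>M) (\<integral>\<omega>. f (Y \<omega>) \<partial>M) < e"
    using expectation_L0_nbhd[OF f _ e(1)] Y by blast
  then show "\<exists>\<epsilon>>0. \<exists>\<delta>>0. L0_nbhd M Y \<epsilon> \<delta> \<subseteq> {Y \<in> L0 M. (\<integral>\<omega>. f (Y \<omega>) \<partial>M) \<in> U}"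
    using e(2) by (intro exI[of _ a] exI[of _ b] conjI) (auto simp: L0_nbhd_def)
qed auto

locale continuous_random_field = prob_space M
  for M :: "'w measure" +
  fixes X :: "real \<Rightarrow> 'e::complete_space \<Rightarrow> 'w \<Rightarrow> 'e"
  assumes continuous_X:
    "continuous_map (top_of_set ({0..} \<times> UNIV)) (L0_topology M) (\<lambda>(t, x). X t x)"
begin

lemma X_L0: "t \<ge> 0 \<Longrightarrow> X t x \<in> L0 M"
  using continuous_X by (force simp: continuous_map)

lemma X_measurable: "t \<ge> 0 \<Longrightarrow> X t x \<in> borel_measurable M"
  by (simp add: X_L0 L0_borel_measurable)

lemma continuous_on_expectation:
  fixes f :: "'e \<Rightarrow> 'b::{banach, second_countable_topology}"
  assumes "f \<in> bcontfun"
  shows "continuous_on ({0..} \<times> UNIV) (\<lambda>(t, x). \<integral>\<omega>. f (X t x \<omega>) \<partial>M)"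
proof -
  have "continuous_map (top_of_set ({0..} \<times> UNIV)) euclidean
      ((\<lambda>Y. \<integral>\<omega>. f (Y \<omega>) \<partial>M) \<circ> (\<lambda>(t, x). X t x))"
    using continuous_X continuous_map_expectation_L0[OF assms] by (rule continuous_map_compose)
  then show ?thesis by (simp add: o_def case_prod_beta)
qed

section \<open>Finite approximation and tightness of the laws\<close>

lemma infdist_bcontfun: "(\<lambda>y::'e. min 1 (infdist y F)) \<in> bcontfun"
proof -
  have "continuous_on UNIV (\<lambda>y::'e. min 1 (infdist y F))" by (intro continuous_intros)
  moreover have "bounded (range (\<lambda>y::'e. min 1 (infdist y F)))"
    by (rule boundedI[of _ 1]) (auto simp: infdist_nonneg)
  ultimately show ?thesis by (simp add: bcontfun_def)
qed

text \<open>The finite set is the range of a simple function approximating \<open>Y\<close>. The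
  truncation at 1 supplies the dominating function. Nonemptiness is recorded because
  \<open>infdist\<close> to the empty set is 0 by convention, which would make the estimate
  void.\<close>

lemma finite_approximation:
  assumes Y: "Y \<in> L0 M" and e: "e > 0"
  obtains F :: "'e set" where "finite F" "F \<noteq> {}" "(\<integral>\<omega>. min 1 (infdist (Y \<omega>) F) \<partial>M) < e"
proof -
  obtain s where s: "\<And>n::nat. simple_function M (s n)"
      "\<And>\<omega>. \<omega> \<in> space M \<Longrightarrow> (\<lambda>n. s n \<omega>) \<longlonglongrightarrow> Y \<omega>"
    using Y by (auto simp: L0_def strongly_measurable_def)
  note [measurable] = L0_borel_measurable[OF Y]
  have "(\<lambda>n. \<integral>\<omega>. min 1 (infdist (Y \<omega>) (s n ` space M)) \<partial>M) \<longlonglongrightarrow> (\<integral>\<omega>. 0 \<partial>M)"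
  proof (rule integral_dominated_convergence[where w="\<lambda>_. 1"])
    show "AE \<omega> in M. (\<lambda>n. min 1 (infdist (Y \<omega>) (s n ` space M))) \<longlonglongrightarrow> 0"
    proof (rule AE_I2)
      fix \<omega> assume w: "\<omega> \<in> space M"
      have "(\<lambda>n. dist (Y \<omega>) (s n \<omega>)) \<longlonglongrightarrow> dist (Y \<omega>) (Y \<omega>)"
        by (intro tendsto_intros s w)
      then have lim: "(\<lambda>n. dist (Y \<omega>) (s n \<omega>)) \<longlonglongrightarrow> 0" by simp
      show "(\<lambda>n. min 1 (infdist (Y \<omega>) (s n ` space M))) \<longlonglongrightarrow> 0"
      proof (rule tendsto_sandwich[OF always_eventually always_eventually tendsto_const lim])
        show "\<forall>n. 0 \<le> min 1 (infdist (Y \<omega>) (s n ` space M))" by (simp add: infdist_nonneg)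
        show "\<forall>n. min 1 (infdist (Y \<omega>) (s n ` space M)) \<le> dist (Y \<omega>) (s n \<omega>)"
          using w by (intro allI min.coboundedI2 infdist_le) auto
      qed
    qed
    show "(\<lambda>\<omega>. min 1 (infdist (Y \<omega>) (s n ` space M))) \<in> borel_measurable M" for n
      using bcontfun_borel_measurable[OF infdist_bcontfun] by measurable
  qed (auto simp: infdist_nonneg)
  then have "\<forall>\<^sub>F n in sequentially. (\<integral>\<omega>. min 1 (infdist (Y \<omega>) (s n ` space M)) \<partial>M) < e"
    using e by (auto dest: order_tendstoD(2))
  then obtain n where "(\<integral>\<omega>. min 1 (infdist (Y \<omega>) (s n ` space M)) \<partial>M) < e"
    by (auto simp: eventually_sequentially)
  then show thesis
    using that[of "s n ` space M"] s(1)[of n] not_empty by (auto simp: simple_function_def)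
qed

text \<open>By continuity each finite \<open>F\<close> serves a relatively open part of
  \<open>C\<close>. Finitely many such parts cover \<open>C\<close>, and passing to the union of
  their sets only decreases the distance.\<close>

lemma finite_approximation_compact:
  assumes C: "compact C" "C \<subseteq> {0..} \<times> UNIV" and e: "e > 0"
  obtains F :: "'e set" where "finite F" "F \<noteq> {}"
    "\<And>t x. (t, x) \<in> C \<Longrightarrow> (\<integral>\<omega>. min 1 (infdist (X t x \<omega>) F) \<partial>M) < e"
proof -
  define h where "h F = (\<lambda>(t, x). \<integral>\<omega>. min 1 (infdist (X t x \<omega>) F) \<partial>M)" for F
  let ?\<F> = "{F. finite F \<and> F \<noteq> {}}"
  have "\<exists>V. open V \<and> {z \<in> C. h F z < e} = C \<inter> V" for F
  proof -
    have "continuous_on C (h F)"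
      using continuous_on_subset[OF continuous_on_expectation[OF infdist_bcontfun] C(2)]
      by (simp add: h_def)
    then have "openin (top_of_set C) (C \<inter> h F -` {..<e})"
      by (intro continuous_openin_preimage_gen) auto
    then show ?thesis by (auto simp: openin_open)
  qed
  then obtain V where V: "\<And>F. open (V F)" "\<And>F. {z \<in> C. h F z < e} = C \<inter> V F" by metis
  have cover: "C \<subseteq> (\<Union>F\<in>?\<F>. V F)"
  proof
    fix z assume z: "z \<in> C"
    obtain t x where tx: "z = (t, x)" by (cases z)
    have "X t x \<in> L0 M" using z C(2) tx by (auto intro: X_L0)
    then obtain F where "finite F" "F \<noteq> {}" "h F z < e"
      using finite_approximation[OF _ e] by (auto simp: h_def tx)
    then show "z \<in> (\<Union>F\<in>?\<F>. V F)" using V(2)[of F] z by auto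
  qed
  obtain \<G> where \<G>: "\<G> \<subseteq> ?\<F>" "finite \<G>" "C \<subseteq> (\<Union>F\<in>\<G>. V F)"
    by (rule compactE_image[OF C(1) V(1) cover])
  show thesis
  \<comment> \<open>The extra point keeps the set nonempty when the subcover is empty, which happens
    only for empty \<open>C\<close>.\<close>
  proof (rule that[of "insert undefined (\<Union>\<G>)"])
    fix t x assume tx: "(t, x) \<in> C"
    then obtain F where F: "F \<in> \<G>" "(t, x) \<in> V F" using \<G> by auto
    then have "h F (t, x) < e" using V(2)[of F] tx by auto
    moreover have "X t x \<in> L0 M" using tx C(2) by (auto intro: X_L0)
    then have "(\<integral>\<omega>. min 1 (infdist (X t x \<omega>) (insert undefined (\<Union>\<G>))) \<partial>M) \<le> h F (t, x)"
      unfolding h_def prod.case using F(1) \<G>(1)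
      by (intro integral_mono integrable_bcontfun_L0 infdist_bcontfun min.mono infdist_mono) auto
    ultimately show "(\<integral>\<omega>. min 1 (infdist (X t x \<omega>) (insert undefined (\<Union>\<G>))) \<partial>M) < e"
      by linarith
  qed (use \<G> in auto)
qed

text \<open>Ulam's argument, uniformly over \<open>C\<close>: an intersection of closed
  \<open>d k\<close>-neighbourhoods of finite sets with \<open>d k\<close> tending to 0 is closed
  and totally bounded, hence compact in a complete space.\<close>

lemma uniformly_tight:
  assumes C: "compact C" "C \<subseteq> {0..} \<times> UNIV" and e: "e > 0"
  obtains K where "compact K" "\<And>t x. (t, x) \<in> C \<Longrightarrow> prob {\<omega>\<in>space M. X t x \<omega> \<notin> K} \<le> e"
proof -
  define d where "d k = (1/2::real)^k" for k
  have d: "d k > 0" "d k \<le> 1" for k by (auto simp: d_def power_le_one)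
  \<comment> \<open>The factor \<open>d k\<close> is consumed by Markov's inequality at the
    threshold \<open>d k\<close>; the remaining bounds \<open>e * (1/2)^Suc k\<close> sum to
    \<open>e\<close>.\<close>
  have "\<exists>F::'e set. finite F \<and> F \<noteq> {} \<and>
    (\<forall>t x. (t, x) \<in> C \<longrightarrow> (\<integral>\<omega>. min 1 (infdist (X t x \<omega>) F) \<partial>M) < e * (1/2)^Suc k * d k)" for k
    using finite_approximation_compact[OF C, of "e * (1/2)^Suc k * d k"] e d(1)[of k]
    by (metis mult_pos_pos zero_less_divide_1_iff zero_less_numeral zero_less_power)
  then obtain F :: "nat \<Rightarrow> 'e set" where F: "\<And>k. finite (F k)" "\<And>k. F k \<noteq> {}"
    "\<And>k t x. (t, x) \<in> C \<Longrightarrow> (\<integral>\<omega>. min 1 (infdist (X t x \<omega>) (F k)) \<partial>M) < e * (1/2)^Suc k * d k"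
    by metis
  define K where "K = (\<Inter>k. {y. infdist y (F k) \<le> d k})"
  have "closed K" unfolding K_def
    by (intro closed_INT ballI closed_Collect_le continuous_intros)
  moreover have "\<exists>k. finite k \<and> K \<subseteq> (\<Union>x\<in>k. ball x r)" if "r > 0" for r
  proof -
    obtain k where k: "d k < r"
      using real_arch_pow_inv[of r "1/2"] \<open>r > 0\<close> by (auto simp: d_def)
    have "K \<subseteq> (\<Union>x\<in>F k. ball x r)"
    proof
      fix y assume "y \<in> K"
      then have "infdist y (F k) \<le> d k" by (auto simp: K_def)
      then have "infdist y (F k) < r" using k by linarith
      then obtain z where "z \<in> F k" "dist y z < r"
        using F(2)[of k] by (auto simp: infdist_notempty cINF_less_iff)
      then show "y \<in> (\<Union>x\<in>F k. ball x r)" by (auto simp: dist_commute)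
    qed
    then show ?thesis using F(1) by blast
  qed
  ultimately have K: "compact K" by (auto simp: compact_eq_totally_bounded complete_eq_closed)
  show thesis
  proof (rule that[OF K])
    fix t x assume tx: "(t, x) \<in> C"
    then have XL: "X t x \<in> L0 M" using C(2) by (auto intro: X_L0)
    note [measurable] = L0_borel_measurable[OF XL] bcontfun_borel_measurable[OF infdist_bcontfun]
    have mb: "{\<omega>\<in>space M. d k \<le> min 1 (infdist (X t x \<omega>) (F k))} \<in> sets M" for k by measurable
    have "prob {\<omega>\<in>space M. d k \<le> min 1 (infdist (X t x \<omega>) (F k))} \<le> e * (1/2)^Suc k" for k
    proof -
      have "prob {\<omega>\<in>space M. d k \<le> min 1 (infdist (X t x \<omega>) (F k))}
          \<le> (\<integral>\<omega>. min 1 (infdist (X t x \<omega>) (F k)) \<partial>M) / d k"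
        by (rule integral_Markov_inequality_measure[OF integrable_bcontfun_L0[OF infdist_bcontfun XL] sets.top])
          (auto simp: infdist_nonneg d)
      also have "\<dots> \<le> e * (1/2)^Suc k * d k / d k"
        using F(3)[OF tx, of k] d(1)[of k] by (intro divide_right_mono) auto
      also have "\<dots> = e * (1/2)^Suc k" using d(1)[of k] by simp
      finally show ?thesis .
    qed
    note le = this
    have sums: "(\<lambda>k. e * (1/2)^Suc k) sums e" using sums_mult[OF power_half_series, of e] by simp
    have summ: "summable (\<lambda>k. prob {\<omega>\<in>space M. d k \<le> min 1 (infdist (X t x \<omega>) (F k))})"
      by (rule summable_comparison_test'[OF sums_summable[OF sums], of 0]) (use le in auto)
    have "prob {\<omega>\<in>space M. X t x \<omega> \<notin> K}
        \<le> prob (\<Union>k. {\<omega>\<in>space M. d k \<le> min 1 (infdist (X t x \<omega>) (F k))})"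
    proof (rule finite_measure_mono)
      \<comment> \<open>Since \<open>d k \<le> 1\<close>, truncating the distance at 1 does not hide
        that it exceeds \<open>d k\<close>.\<close>
      show "{\<omega>\<in>space M. X t x \<omega> \<notin> K} \<subseteq> (\<Union>k. {\<omega>\<in>space M. d k \<le> min 1 (infdist (X t x \<omega>) (F k))})"
        using d(2) by (auto simp: K_def not_le intro: less_imp_le)
      show "(\<Union>k. {\<omega>\<in>space M. d k \<le> min 1 (infdist (X t x \<omega>) (F k))}) \<in> sets M"
        by (rule sets.countable_nat_UN) (use mb in blast)
    qed
    also have "\<dots> \<le> (\<Sum>k. prob {\<omega>\<in>space M. d k \<le> min 1 (infdist (X t x \<omega>) (F k))})"
      by (rule finite_measure_subadditive_countably[OF _ summ]) (use mb in blast)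
    also have "\<dots> \<le> (\<Sum>k. e * (1/2)^Suc k)"
      by (intro suminf_le le summ sums_summable[OF sums])
    also have "\<dots> = e" using sums by (rule sums_unique[symmetric])
    finally show "prob {\<omega>\<in>space M. X t x \<omega> \<notin> K} \<le> e" .
  qed
qed

end


section \<open>The strict topology\<close>

lemma bcontfun_diff:
  fixes f g :: "'a::topological_space \<Rightarrow> 'b::real_normed_vector"
  assumes "f \<in> bcontfun" "g \<in> bcontfun"
  shows "(\<lambda>x. f x - g x) \<in> bcontfun"
  using assms by (auto simp: bcontfun_def intro!: continuous_intros bounded_minus_comp)

lemma bcontfun_cmult:
  fixes f :: "'a::topological_space \<Rightarrow> 'b::real_normed_algebra"
  assumes "f \<in> bcontfun"
  shows "(\<lambda>x. c * f x) \<in> bcontfun"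
proof -
  obtain B where "\<And>x. norm (f x) \<le> B" using bcontfun_normE[OF assms] by blast
  then have "norm (c * f x) \<le> norm c * B" for x
    by (meson mult_left_mono norm_ge_zero norm_mult_ineq order_trans)
  then show ?thesis
    using assms by (auto simp: bcontfun_def bounded_iff intro!: continuous_intros)
qed

lemma strict_weights_normE:
  assumes "\<phi> \<in> strict_weights"
  obtains B where "B > 0" "\<And>x. cmod (\<phi> x) \<le> B"
proof -
  obtain B where "\<And>x. cmod (\<phi> x) \<le> B"
    using assms by (auto simp: strict_weights_def bounded_iff)
  then show thesis
    by (intro that[of "max B 1"]) (auto simp: le_max_iff_disj)
qed

lemma strict_weightsI:
  assumes "\<And>x. cmod (\<phi> x) \<le> B"
    and "\<And>\<epsilon>. \<epsilon> > 0 \<Longrightarrow> \<exists>K. compact K \<and> (\<forall>x. x \<notin> K \<longrightarrow> cmod (\<phi> x) \<le> \<epsilon>)"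
  shows "\<phi> \<in> strict_weights"
  using assms by (auto simp: strict_weights_def vanishing_at_infinity_def bounded_iff)

lemma strict_weights_compactE:
  assumes "\<phi> \<in> strict_weights" "\<epsilon> > 0"
  obtains K where "compact K" "\<And>x. x \<notin> K \<Longrightarrow> cmod (\<phi> x) \<le> \<epsilon>"
  using assms by (auto simp: strict_weights_def vanishing_at_infinity_def)

lemma strict_weights_cmult:
  assumes "\<phi> \<in> strict_weights"
  shows "(\<lambda>x. c * \<phi> x) \<in> strict_weights"
proof -
  obtain B where B: "B > 0" "\<And>x. cmod (\<phi> x) \<le> B" using strict_weights_normE[OF assms] by blast
  show ?thesis
  proof (rule strict_weightsI[where B="cmod c * B"])
    fix e :: real assume e: "e > 0"
    \<comment> \<open>Dividing by \<open>cmod c + 1\<close> covers \<open>c = 0\<close> without a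
      case distinction.\<close>
    have c: "0 < cmod c + 1" by (simp add: add_nonneg_pos)
    obtain K where K: "compact K" "\<And>x. x \<notin> K \<Longrightarrow> cmod (\<phi> x) \<le> e / (cmod c + 1)"
      using strict_weights_compactE[OF assms, of "e / (cmod c + 1)"] e c by auto
    have "cmod (c * \<phi> x) \<le> e" if "x \<notin> K" for x
    proof -
      have "cmod (c * \<phi> x) \<le> (cmod c + 1) * (e / (cmod c + 1))"
        unfolding norm_mult using K(2)[OF that] by (intro mult_mono) auto
      then show ?thesis using c by simp
    qed
    then show "\<exists>K. compact K \<and> (\<forall>x. x \<notin> K \<longrightarrow> cmod (c * \<phi> x) \<le> e)" using K(1) by blast
  qed (auto simp: norm_mult intro!: mult_left_mono B)
qed

text \<open>This makes the weighted norms directed: one weight dominates two given ones. Moduli are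
  added because a sum of complex weights could cancel.\<close>

lemma strict_weights_add:
  assumes "\<phi> \<in> strict_weights" "\<psi> \<in> strict_weights"
  shows "(\<lambda>x. complex_of_real (cmod (\<phi> x) + cmod (\<psi> x))) \<in> strict_weights"
proof -
  obtain B where B: "B > 0" "\<And>x. cmod (\<phi> x) \<le> B" using strict_weights_normE[OF assms(1)] by blast
  obtain B' where B': "B' > 0" "\<And>x. cmod (\<psi> x) \<le> B'" using strict_weights_normE[OF assms(2)] by blast
  have n: "cmod (complex_of_real (cmod (\<phi> x) + cmod (\<psi> x))) = cmod (\<phi> x) + cmod (\<psi> x)" for x
    unfolding norm_of_real by simp
  show ?thesis
  proof (rule strict_weightsI[where B="B + B'"])
    fix e :: real assume e: "e > 0"
    obtain K where K: "compact K" "\<And>x. x \<notin> K \<Longrightarrow> cmod (\<phi> x) \<le> e/2"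
      using strict_weights_compactE[OF assms(1), of "e/2"] e by auto
    obtain L where L: "compact L" "\<And>x. x \<notin> L \<Longrightarrow> cmod (\<psi> x) \<le> e/2"
      using strict_weights_compactE[OF assms(2), of "e/2"] e by auto
    show "\<exists>K. compact K \<and> (\<forall>x. x \<notin> K \<longrightarrow> cmod (complex_of_real (cmod (\<phi> x) + cmod (\<psi> x))) \<le> e)"
      unfolding n using compact_Un[OF K(1) L(1)] K(2) L(2) by (intro exI[of _ "K \<union> L"]) force
  qed (auto simp only: n intro!: add_mono B(2) B'(2))
qed

section \<open>Weighted supremum seminorms\<close>

lemma weighted_norm_upper:
  assumes "\<phi> \<in> strict_weights" "f \<in> Cb"
  shows "cmod (\<phi> x * f x) \<le> weighted_norm \<phi> f"
proof -
  obtain B where B: "B > 0" "\<And>x. cmod (\<phi> x) \<le> B" using strict_weights_normE[OF assms(1)] by blast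
  obtain B' where B': "\<And>x. norm (f x) \<le> B'" using bcontfun_normE[OF assms(2)] by blast
  have "cmod (\<phi> x * f x) \<le> B * B'" for x
    unfolding norm_mult using B B' by (intro mult_mono) auto
  then show ?thesis
    unfolding weighted_norm_def by (intro cSUP_upper) (auto intro: bdd_aboveI[where M="B * B'"])
qed

lemma weighted_norm_least:
  "(\<And>x. cmod (\<phi> x * f x) \<le> c) \<Longrightarrow> weighted_norm \<phi> f \<le> c"
  unfolding weighted_norm_def by (intro cSUP_least) auto

lemma weighted_norm_nonneg: "\<phi> \<in> strict_weights \<Longrightarrow> f \<in> Cb \<Longrightarrow> 0 \<le> weighted_norm \<phi> f"
  using weighted_norm_upper[of \<phi> f] by (meson norm_ge_zero order_trans)

lemma weighted_norm_add:
  assumes "\<phi> \<in> strict_weights" "f \<in> Cb" "g \<in> Cb"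
  shows "weighted_norm \<phi> (\<lambda>x. f x + g x) \<le> weighted_norm \<phi> f + weighted_norm \<phi> g"
proof (rule weighted_norm_least)
  fix x
  show "cmod (\<phi> x * (f x + g x)) \<le> weighted_norm \<phi> f + weighted_norm \<phi> g"
    unfolding distrib_left
    by (intro order_trans[OF norm_triangle_ineq] add_mono weighted_norm_upper assms)
qed

lemma weighted_norm_cmult:
  assumes "\<phi> \<in> strict_weights" "f \<in> Cb"
  shows "weighted_norm \<phi> (\<lambda>x. c * f x) = cmod c * weighted_norm \<phi> f"
proof -
  have le: "weighted_norm \<phi> (\<lambda>x. c * f x) \<le> cmod c * weighted_norm \<phi> f" if "f \<in> Cb" for c f
  proof (rule weighted_norm_least)
    fix x
    have "cmod c * cmod (\<phi> x * f x) \<le> cmod c * weighted_norm \<phi> f"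
      by (intro mult_left_mono weighted_norm_upper assms that) auto
    then show "cmod (\<phi> x * (c * f x)) \<le> cmod c * weighted_norm \<phi> f"
      by (simp add: norm_mult mult_ac)
  qed
  show ?thesis
  proof (cases "c = 0")
    case False
    have "weighted_norm \<phi> f \<le> cmod (1 / c) * weighted_norm \<phi> (\<lambda>x. c * f x)"
      using le[OF bcontfun_cmult[OF assms(2)], of "1/c" c] False by simp
    then have "cmod c * weighted_norm \<phi> f \<le> weighted_norm \<phi> (\<lambda>x. c * f x)"
      using False by (simp add: norm_divide field_simps)
    then show ?thesis using le[OF assms(2), of c] by linarith
  qed (simp add: weighted_norm_def)
qed

lemma weighted_norm_cmult_weight:
  assumes "\<phi> \<in> strict_weights" "f \<in> Cb"
  shows "weighted_norm (\<lambda>x. c * \<phi> x) f = cmod c * weighted_norm \<phi> f"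
  using weighted_norm_cmult[OF assms, of c] by (simp add: weighted_norm_def mult_ac)

lemma weighted_norm_mono:
  assumes "\<psi> \<in> strict_weights" "f \<in> Cb" "\<And>x. cmod (\<phi> x) \<le> cmod (\<psi> x)"
  shows "weighted_norm \<phi> f \<le> weighted_norm \<psi> f"
proof (rule weighted_norm_least)
  fix x
  have "cmod (\<phi> x * f x) \<le> cmod (\<psi> x * f x)"
    unfolding norm_mult by (intro mult_right_mono assms) auto
  then show "cmod (\<phi> x * f x) \<le> weighted_norm \<psi> f"
    using weighted_norm_upper[OF assms(1,2)] order_trans by blast
qed

lemma weighted_norm_triangle:
  assumes "\<phi> \<in> strict_weights" "f \<in> Cb" "g \<in> Cb" "h \<in> Cb"
  shows "weighted_norm \<phi> (\<lambda>x. f x - h x)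
    \<le> weighted_norm \<phi> (\<lambda>x. f x - g x) + weighted_norm \<phi> (\<lambda>x. g x - h x)"
  using weighted_norm_add[OF assms(1) bcontfun_diff[OF assms(2,3)] bcontfun_diff[OF assms(3,4)]]
  by simp

lemma weighted_norm_zero [simp]: "weighted_norm \<phi> (\<lambda>x. 0) = 0"
  by (simp add: weighted_norm_def)

section \<open>Neighbourhoods, seminorms and equicontinuity in the strict topology\<close>

lemma openin_strict_ball:
  assumes "\<phi> \<in> strict_weights" "f \<in> Cb" "r > 0"
  shows "openin strict_topology {g \<in> Cb. weighted_norm \<phi> (\<lambda>x. g x - f x) < r}"
  unfolding strict_topology_def using assms by (intro topology_generated_by_Basis) blast

text \<open>The generating balls have arbitrary centres and radii, but around a point of an open set
  one weight and radius 1 suffice: intersections are handled by directedness, a shifted centre by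
  the triangle inequality, and the radius by rescaling the weight.\<close>

lemma openin_strict_topologyD:
  assumes "openin strict_topology U" "f \<in> U"
  obtains \<phi> where "\<phi> \<in> strict_weights"
    "{g \<in> Cb. weighted_norm \<phi> (\<lambda>x. g x - f x) < 1} \<subseteq> U"
proof -
  let ?B = "\<lambda>\<phi>. {g \<in> Cb. weighted_norm \<phi> (\<lambda>x. g x - f x) < 1}"
  let ?G = "{{g \<in> Cb. weighted_norm \<phi> (\<lambda>x. g x - f x) < r} | \<phi> f r.
          \<phi> \<in> strict_weights \<and> f \<in> Cb \<and> r > 0} :: ('a \<Rightarrow> complex) set set"
  have "generate_topology_on ?G U"
    using assms(1) by (simp add: strict_topology_def openin_topology_generated_by_iff)
  moreover have "f \<in> Cb"
    using openin_subset[OF assms(1)] assms(2) by auto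
  ultimately have "\<exists>\<phi>\<in>strict_weights. ?B \<phi> \<subseteq> U"
    using assms(2)
  proof induction
    case (Int a b)
    then obtain \<phi> \<psi> where \<phi>: "\<phi> \<in> strict_weights" "?B \<phi> \<subseteq> a"
      and \<psi>: "\<psi> \<in> strict_weights" "?B \<psi> \<subseteq> b" by blast
    let ?\<chi> = "\<lambda>x. complex_of_real (cmod (\<phi> x) + cmod (\<psi> x))"
    have \<chi>: "?\<chi> \<in> strict_weights" using strict_weights_add[OF \<phi>(1) \<psi>(1)] .
    have "cmod (?\<chi> x) = cmod (\<phi> x) + cmod (\<psi> x)" for x unfolding norm_of_real by simp
    then have le: "weighted_norm \<phi> (\<lambda>x. g x - f x) \<le> weighted_norm ?\<chi> (\<lambda>x. g x - f x)"
      "weighted_norm \<psi> (\<lambda>x. g x - f x) \<le> weighted_norm ?\<chi> (\<lambda>x. g x - f x)" if "g \<in> Cb" for g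
      using that Int.prems by (auto intro!: weighted_norm_mono \<chi>[unfolded of_real_add] bcontfun_diff)
    have "?B ?\<chi> \<subseteq> ?B \<phi>" "?B ?\<chi> \<subseteq> ?B \<psi>" using le by (auto intro: le_less_trans)
    then show ?case using \<chi> \<phi>(2) \<psi>(2) by (intro bexI[of _ ?\<chi>]) auto
  next
    case (UN K)
    then show ?case by blast
  next
    case (Basis s)
    then obtain \<phi> h r where s: "s = {g \<in> Cb. weighted_norm \<phi> (\<lambda>x. g x - h x) < r}"
      and \<phi>: "\<phi> \<in> strict_weights" and h: "h \<in> Cb" and r: "r > 0" by blast
    \<comment> \<open>The slack of \<open>f\<close> inside the ball around \<open>h\<close>; the
      weight \<open>\<phi>\<close> divided by \<open>d\<close> turns the ball of radius
      \<open>d\<close> around \<open>f\<close> into a unit ball.\<close>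
    define d where "d = r - weighted_norm \<phi> (\<lambda>x. f x - h x)"
    have d: "d > 0" using Basis(3) by (auto simp: d_def s)
    let ?\<chi> = "\<lambda>x. complex_of_real (1/d) * \<phi> x"
    have \<chi>: "?\<chi> \<in> strict_weights" by (rule strict_weights_cmult[OF \<phi>])
    have "?B ?\<chi> \<subseteq> s"
    proof
      fix g assume g: "g \<in> ?B ?\<chi>"
      then have "weighted_norm ?\<chi> (\<lambda>x. g x - f x) = 1/d * weighted_norm \<phi> (\<lambda>x. g x - f x)"
        using weighted_norm_cmult_weight[OF \<phi> bcontfun_diff[of g f], of "complex_of_real (1/d)"]
          Basis(2) d by (simp add: norm_divide)
      then have "1/d * weighted_norm \<phi> (\<lambda>x. g x - f x) < 1" using g by (auto simp only: mem_Collect_eq)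
      then have "weighted_norm \<phi> (\<lambda>x. g x - f x) < d" using d by (simp add: divide_simps)
      moreover have "weighted_norm \<phi> (\<lambda>x. g x - h x)
          \<le> weighted_norm \<phi> (\<lambda>x. g x - f x) + weighted_norm \<phi> (\<lambda>x. f x - h x)"
        using g Basis(2) h by (intro weighted_norm_triangle \<phi>) auto
      ultimately show "g \<in> s" using g by (auto simp: s d_def)
    qed
    then show ?case using \<chi> by blast
  qed auto
  then show thesis using that by blast
qed

lemma openin_strict_topologyI:
  assumes "U \<subseteq> Cb"
    and "\<And>f. f \<in> U \<Longrightarrow> \<exists>\<phi>\<in>strict_weights. {g \<in> Cb. weighted_norm \<phi> (\<lambda>x. g x - f x) < 1} \<subseteq> U"
  shows "openin strict_topology U"
proof (subst openin_subopen, intro ballI)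
  fix f assume f: "f \<in> U"
  obtain \<phi> where \<phi>: "\<phi> \<in> strict_weights" "{g \<in> Cb. weighted_norm \<phi> (\<lambda>x. g x - f x) < 1} \<subseteq> U"
    using assms(2)[OF f] by blast
  show "\<exists>T. openin strict_topology T \<and> f \<in> T \<and> T \<subseteq> U"
    using f assms(1) \<phi>
    by (intro exI[of _ "{g \<in> Cb. weighted_norm \<phi> (\<lambda>x. g x - f x) < 1}"] conjI openin_strict_ball) auto
qed

lemma strict_continuous_seminorm_weighted_norm:
  assumes \<phi>: "\<phi> \<in> strict_weights"
  shows "strict_continuous_seminorm (weighted_norm \<phi>)"
proof -
  have "continuous_map strict_topology euclideanreal (weighted_norm \<phi>)"
    unfolding continuous_map
  proof (intro conjI allI impI)
    fix V :: "real set" assume V: "openin euclideanreal V"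
    show "openin strict_topology {f \<in> topspace strict_topology. weighted_norm \<phi> f \<in> V}"
    proof (rule openin_strict_topologyI)
      fix f assume f: "f \<in> {f \<in> topspace strict_topology. weighted_norm \<phi> f \<in> V}"
      then obtain e where e: "e > 0" "\<And>y. dist y (weighted_norm \<phi> f) < e \<Longrightarrow> y \<in> V"
        using V by (auto simp: open_dist)
      let ?\<chi> = "\<lambda>x. complex_of_real (1/e) * \<phi> x"
      have "g \<in> {f \<in> topspace strict_topology. weighted_norm \<phi> f \<in> V}"
        if g: "g \<in> Cb" "weighted_norm ?\<chi> (\<lambda>x. g x - f x) < 1" for g
      proof -
        have fC: "f \<in> Cb" using f by simp
        have "weighted_norm ?\<chi> (\<lambda>x. g x - f x) = 1/e * weighted_norm \<phi> (\<lambda>x. g x - f x)"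
          using weighted_norm_cmult_weight[OF \<phi> bcontfun_diff[OF g(1) fC], of "complex_of_real (1/e)"] e(1)
          by (simp add: norm_divide)
        then have "1/e * weighted_norm \<phi> (\<lambda>x. g x - f x) < 1" using g(2) by (simp only:)
        then have "weighted_norm \<phi> (\<lambda>x. g x - f x) < e" using e(1) by (simp add: divide_simps)
        moreover have "weighted_norm \<phi> (\<lambda>x. f x - g x) = weighted_norm \<phi> (\<lambda>x. g x - f x)"
          using weighted_norm_cmult[OF \<phi> bcontfun_diff[OF g(1) fC], of "-1"] by simp
        moreover have "weighted_norm \<phi> g \<le> weighted_norm \<phi> (\<lambda>x. g x - f x) + weighted_norm \<phi> f"
          using weighted_norm_add[OF \<phi> bcontfun_diff[OF g(1) fC] fC] by simp
        moreover have "weighted_norm \<phi> f \<le> weighted_norm \<phi> (\<lambda>x. f x - g x) + weighted_norm \<phi> g"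
          using weighted_norm_add[OF \<phi> bcontfun_diff[OF fC g(1)] g(1)] by simp
        ultimately have "dist (weighted_norm \<phi> g) (weighted_norm \<phi> f) < e"
          by (simp add: dist_real_def)
        then show ?thesis using e(2) g(1) by simp
      qed
      then show "\<exists>\<phi>'\<in>strict_weights. {g \<in> Cb. weighted_norm \<phi>' (\<lambda>x. g x - f x) < 1}
          \<subseteq> {f \<in> topspace strict_topology. weighted_norm \<phi> f \<in> V}"
        using strict_weights_cmult[OF \<phi>, of "complex_of_real (1/e)"] by blast
    qed auto
  qed auto
  then show ?thesis
    using \<phi> by (simp add: strict_continuous_seminorm_def weighted_norm_nonneg weighted_norm_add
        weighted_norm_cmult)
qed

text \<open>Continuity at 0 bounds \<open>p\<close> by 1 on the unit ball of some weighted norm, and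
  homogeneity extends this to all of \<open>Cb\<close>.\<close>

lemma strict_continuous_seminorm_le_weighted_norm:
  assumes p: "strict_continuous_seminorm p"
  obtains \<phi> where "\<phi> \<in> strict_weights" "\<And>f. f \<in> Cb \<Longrightarrow> p f \<le> weighted_norm \<phi> f"
proof -
  have pmult: "p (\<lambda>x. c * f x) = cmod c * p f" if "f \<in> Cb" for c f
    using p that by (simp add: strict_continuous_seminorm_def)
  have "openin strict_topology {f \<in> topspace strict_topology. p f \<in> {..<1}}"
    using p by (intro openin_continuous_map_preimage) (auto simp: strict_continuous_seminorm_def)
  moreover have "(\<lambda>_. 0) \<in> {f \<in> topspace strict_topology. p f \<in> {..<1}}"
    using pmult[OF const_bcontfun, of 0] by (simp add: const_bcontfun)
  ultimately obtain \<phi> where \<phi>: "\<phi> \<in> strict_weights"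
    "{g \<in> Cb. weighted_norm \<phi> (\<lambda>x. g x - 0) < 1} \<subseteq> {f \<in> topspace strict_topology. p f \<in> {..<1}}"
    by (rule openin_strict_topologyD)
  have "p f \<le> weighted_norm \<phi> f" if f: "f \<in> Cb" for f
  \<comment> \<open>Scaling by some \<open>c\<close> strictly above the weighted norm, instead of
    the norm itself, avoids dividing by 0.\<close>
  proof (rule dense_ge)
    fix c assume c: "weighted_norm \<phi> f < c"
    then have c0: "c > 0" using weighted_norm_nonneg[OF \<phi>(1) f] by linarith
    have "weighted_norm \<phi> (\<lambda>x. complex_of_real (1/c) * f x) < 1"
      unfolding weighted_norm_cmult[OF \<phi>(1) f] using c c0 by (simp add: norm_divide)
    then have "p (\<lambda>x. complex_of_real (1/c) * f x) < 1"
      using \<phi>(2) bcontfun_cmult[OF f, of "complex_of_real (1/c)"] by auto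
    then show "p f \<le> c" unfolding pmult[OF f] using c0 by (simp add: norm_divide)
  qed
  then show thesis using that \<phi>(1) by blast
qed

text \<open>Weighted norms are continuous seminorms and dominate all the others, so equicontinuity
  may be tested on weights alone. By linearity the same estimate makes each operator
  continuous.\<close>

lemma strict_equicontinuousI:
  fixes S :: "(('a::metric_space \<Rightarrow> complex) \<Rightarrow> ('a \<Rightarrow> complex)) set"
  assumes "\<And>T. T \<in> S \<Longrightarrow> T ` Cb \<subseteq> Cb" "\<And>T. T \<in> S \<Longrightarrow> linear_on_Cb T"
    and "\<And>\<phi>. \<phi> \<in> strict_weights \<Longrightarrow>
      \<exists>\<psi>\<in>strict_weights. \<forall>T\<in>S. \<forall>f\<in>Cb. weighted_norm \<phi> (T f) \<le> weighted_norm \<psi> f"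
  shows "strict_equicontinuous S"
  unfolding strict_equicontinuous_def
proof (intro conjI allI impI subsetI)
  fix T assume T: "T \<in> S"
  have TC: "T f \<in> Cb" if "f \<in> Cb" for f using assms(1)[OF T] that by blast
  have Tdiff: "T (\<lambda>x. g x - f x) = (\<lambda>x. T g x - T f x)" if "f \<in> Cb" "g \<in> Cb" for f g
  proof -
    have "T (\<lambda>x. (-1) * f x) = (\<lambda>x. (-1) * T f x)"
      using assms(2)[OF T] that unfolding linear_on_Cb_def by blast
    moreover have "T (\<lambda>x. g x + (-1) * f x) = (\<lambda>x. T g x + T (\<lambda>x. (-1) * f x) x)"
      using assms(2)[OF T] that bcontfun_cmult[OF that(1), of "-1"] unfolding linear_on_Cb_def
      by (elim conjE ballE[where x=g] ballE[where x="\<lambda>x. (-1) * f x"]) auto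
    ultimately show ?thesis by simp
  qed
  have "continuous_map strict_topology strict_topology T"
    unfolding continuous_map
  proof (intro conjI allI impI)
    fix U :: "('a \<Rightarrow> complex) set" assume U: "openin strict_topology U"
    show "openin strict_topology {f \<in> topspace strict_topology. T f \<in> U}"
    proof (rule openin_strict_topologyI)
      fix f assume f: "f \<in> {f \<in> topspace strict_topology. T f \<in> U}"
      then obtain \<phi> where \<phi>: "\<phi> \<in> strict_weights"
        "{g \<in> Cb. weighted_norm \<phi> (\<lambda>x. g x - T f x) < 1} \<subseteq> U"
        using openin_strict_topologyD[OF U] by blast
      obtain \<psi> where \<psi>: "\<psi> \<in> strict_weights"
        "\<And>f. f \<in> Cb \<Longrightarrow> weighted_norm \<phi> (T f) \<le> weighted_norm \<psi> f"
        using assms(3)[OF \<phi>(1)] T by blast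
      have "T g \<in> U" if g: "g \<in> Cb" "weighted_norm \<psi> (\<lambda>x. g x - f x) < 1" for g
      proof -
        have "weighted_norm \<phi> (\<lambda>x. T g x - T f x) < 1"
          using \<psi>(2)[OF bcontfun_diff[OF g(1), of f]] Tdiff[of f g] f g by auto
        then show ?thesis using \<phi>(2) TC[OF g(1)] by blast
      qed
      then show "\<exists>\<psi>\<in>strict_weights. {g \<in> Cb. weighted_norm \<psi> (\<lambda>x. g x - f x) < 1}
          \<subseteq> {f \<in> topspace strict_topology. T f \<in> U}"
        using \<psi>(1) by auto
    qed auto
  qed (use TC in auto)
  then show "T \<in> continuous_operators strict_topology"
    using assms(1,2) T by (simp add: continuous_operators_def)
next
  fix p :: "('a \<Rightarrow> complex) \<Rightarrow> real" assume "strict_continuous_seminorm p"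
  then obtain \<phi> where \<phi>: "\<phi> \<in> strict_weights" "\<And>f. f \<in> Cb \<Longrightarrow> p f \<le> weighted_norm \<phi> f"
    using strict_continuous_seminorm_le_weighted_norm by blast
  obtain \<psi> where \<psi>: "\<psi> \<in> strict_weights"
      "\<And>T f. T \<in> S \<Longrightarrow> f \<in> Cb \<Longrightarrow> weighted_norm \<phi> (T f) \<le> weighted_norm \<psi> f"
    using assms(3)[OF \<phi>(1)] by blast
  have "p (T f) \<le> weighted_norm \<psi> f" if "T \<in> S" "f \<in> Cb" for T f
    using \<phi>(2)[of "T f"] \<psi>(2)[OF that] assms(1) that by force
  then show "\<exists>q. strict_continuous_seminorm q \<and> (\<forall>T\<in>S. \<forall>f\<in>Cb. p (T f) \<le> q f)"
    using strict_continuous_seminorm_weighted_norm[OF \<psi>(1)] by blast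
qed


section \<open>Equicontinuity and strict continuity\<close>

context continuous_random_field
begin

abbreviation "T \<equiv> transition_operator M X"

section \<open>Transition operators on bounded continuous functions\<close>

lemma integrable_X:
  fixes f :: "'e \<Rightarrow> 'b::{banach, second_countable_topology}"
  shows "f \<in> bcontfun \<Longrightarrow> t \<ge> 0 \<Longrightarrow> integrable M (\<lambda>\<omega>. f (X t x \<omega>))"
  by (intro integrable_bcontfun_L0 X_L0)

lemma norm_transition_operator_le:
  assumes "f \<in> Cb" "t \<ge> 0" "\<And>y. norm (f y) \<le> B"
  shows "norm (T t f x) \<le> B"
proof -
  have "norm (T t f x) \<le> (\<integral>\<omega>. norm (f (X t x \<omega>)) \<partial>M)"
    unfolding transition_operator_def by (rule integral_norm_bound)
  also have "\<dots> \<le> (\<integral>\<omega>. B \<partial>M)"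
    using assms by (intro integral_mono integrable_norm[OF integrable_X] integrable_const) auto
  finally show ?thesis by (simp add: prob_space)
qed

lemma transition_operator_Cb:
  assumes f: "f \<in> Cb" and t: "t \<ge> 0"
  shows "T t f \<in> Cb"
proof -
  have "continuous_on UNIV ((\<lambda>(t, x). \<integral>\<omega>. f (X t x \<omega>) \<partial>M) \<circ> (\<lambda>x. (t, x)))"
    using t by (intro continuous_on_compose continuous_intros
        continuous_on_subset[OF continuous_on_expectation[OF f]]) auto
  then have "continuous_on UNIV (T t f)" by (simp add: transition_operator_def o_def)
  moreover obtain B where "\<And>x. norm (f x) \<le> B" using bcontfun_normE[OF f] by blast
  then have "bounded (range (T t f))"
    using norm_transition_operator_le[OF f t] by (auto simp: bounded_iff)
  ultimately show ?thesis by (simp add: bcontfun_def)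
qed

lemma linear_transition_operator: "t \<ge> 0 \<Longrightarrow> linear_on_Cb (T t)"
  by (simp add: linear_on_Cb_def transition_operator_def integrable_X)

text \<open>A weighted version of the fact that a tight bounded family of measures integrates one
  common function growing off compact sets; its reciprocal is the new weight. The growth rate
  \<open>2^n\<close> off \<open>K n\<close> must be beaten by the decay of the masses, which
  explains the rate \<open>4^(-n)\<close> asked of \<open>K n\<close>.\<close>

lemma dominating_weight:
  fixes w :: "real \<Rightarrow> real"
  assumes \<phi>: "\<phi> \<in> strict_weights"
    and w: "\<And>t. t \<ge> 0 \<Longrightarrow> \<bar>w t\<bar> \<le> 1" "(w \<longlongrightarrow> 0) at_top"
  shows "\<exists>\<psi>\<in>strict_weights. \<forall>t\<ge>0. \<forall>f\<in>Cb.
    weighted_norm \<phi> (\<lambda>x. w t *\<^sub>R T t f x) \<le> weighted_norm \<psi> f"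
proof -
  obtain B where B: "B > 0" "\<And>x. cmod (\<phi> x) \<le> B" using strict_weights_normE[OF \<phi>] by blast
  define c where "c t x = \<bar>w t\<bar> * cmod (\<phi> x)" for t x
  have c: "0 \<le> c t x" for t x by (simp add: c_def)
  have cB: "c t x \<le> B" if "t \<ge> 0" for t x
    using mult_mono[OF w(1)[OF that] B(2)[of x]] by (simp add: c_def)
  have "\<exists>K. compact K \<and> (\<forall>t\<ge>0. \<forall>x. c t x * prob {\<omega>\<in>space M. X t x \<omega> \<notin> K} \<le> (B + 1) * (1/4)^n)"
    for n
  proof -
    define e where "e = (1/4::real)^n"
    have e: "e > 0" by (simp add: e_def)
    obtain L where L: "compact L" "\<And>x. x \<notin> L \<Longrightarrow> cmod (\<phi> x) \<le> e"
      using strict_weights_compactE[OF \<phi> e] by blast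
    have "eventually (\<lambda>t. \<bar>w t\<bar> < e) at_top"
      using order_tendstoD(2)[OF tendsto_rabs_zero[OF w(2)] e] .
    then obtain s where s: "\<And>t. t \<ge> s \<Longrightarrow> \<bar>w t\<bar> < e" by (auto simp: eventually_at_top_linorder)
    have sub: "{0..s} \<times> L \<subseteq> {0..} \<times> UNIV" by auto
    obtain K where K: "compact K"
      "\<And>t x. (t, x) \<in> {0..s} \<times> L \<Longrightarrow> prob {\<omega>\<in>space M. X t x \<omega> \<notin> K} \<le> e"
      using uniformly_tight[OF compact_Times[OF compact_Icc L(1)] sub e] by blast
    have "c t x * prob {\<omega>\<in>space M. X t x \<omega> \<notin> K} \<le> (B + 1) * e" if t: "t \<ge> 0" for t x
    proof (cases "(t, x) \<in> {0..s} \<times> L")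
      case True
      have "c t x * prob {\<omega>\<in>space M. X t x \<omega> \<notin> K} \<le> B * e"
        using K(2)[OF True] cB[OF t] B(1) by (intro mult_mono) auto
      then show ?thesis using e by (simp add: algebra_simps)
    next
      case False
      \<comment> \<open>Outside the box one of the factors \<open>\<bar>w t\<bar>\<close> and
        \<open>cmod (\<phi> x)\<close> is at most \<open>e\<close>, while the other is bounded by
        \<open>B\<close> or by 1, respectively.\<close>
      have "c t x \<le> max 1 B * e"
      proof (cases "x \<in> L")
        case True
        then have "c t x \<le> e * B" unfolding c_def
          using False t s[of t] B by (intro mult_mono) auto
        also have "\<dots> \<le> max 1 B * e" using e by (simp add: mult.commute)
        finally show ?thesis .
      next
        case False
        then have "c t x \<le> 1 * e" unfolding c_def
          using w(1)[OF t] L(2) by (intro mult_mono) auto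
        also have "\<dots> \<le> max 1 B * e" using e by (intro mult_right_mono) auto
        finally show ?thesis .
      qed
      also have "\<dots> \<le> (B + 1) * e" using B(1) e by (intro mult_right_mono) auto
      finally have "c t x * prob {\<omega>\<in>space M. X t x \<omega> \<notin> K} \<le> (B + 1) * e * 1"
        using c B(1) e by (intro mult_mono) auto
      then show ?thesis by simp
    qed
    then show ?thesis using K(1) by (auto simp: e_def)
  qed
  then obtain K where K: "\<And>n. compact (K n)"
    "\<And>n t x. t \<ge> 0 \<Longrightarrow> c t x * prob {\<omega>\<in>space M. X t x \<omega> \<notin> K n} \<le> (B + 1) * (1/4)^n"
    by metis
  have [measurable]: "K n \<in> sets borel" for n using K(1) by (simp add: compact_imp_closed)
  \<comment> \<open>The weight \<open>D / g\<close> vanishes at infinity because \<open>g \<ge> 2^n\<close> off \<open>K n\<close>, while the mass of the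
    laws decays like \<open>4^(-n)\<close> there, so \<open>g\<close> has uniformly bounded integrals.\<close>
  define g where "g y = 1 + (\<Sum>n. 2^n * indicator (- K n) y :: ennreal)" for y
  have [measurable]: "g \<in> borel_measurable borel" unfolding g_def by measurable
  \<comment> \<open>\<open>B\<close> bounds the contribution of the summand 1 in \<open>g\<close>;
    \<open>2 * (B + 1)\<close> is the sum of \<open>2^n * (B + 1) * (1/4)^n\<close>.\<close>
  define D where "D = B + 2 * (B + 1)"
  have D: "D > 0" using B(1) by (simp add: D_def)
  have gint: "ennreal (c t x) * (\<integral>\<^sup>+\<omega>. g (X t x \<omega>) \<partial>M) \<le> ennreal D" if t: "t \<ge> 0" for t x
  proof -
    note [measurable] = X_measurable[OF t]
    have ind: "(\<integral>\<^sup>+\<omega>. indicator (- K n) (X t x \<omega>) \<partial>M) = prob {\<omega>\<in>space M. X t x \<omega> \<notin> K n}" for n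
    proof -
      have "(\<integral>\<^sup>+\<omega>. indicator (- K n) (X t x \<omega>) \<partial>M)
          = (\<integral>\<^sup>+\<omega>. indicator {\<omega>\<in>space M. X t x \<omega> \<notin> K n} \<omega> \<partial>M)"
        by (intro nn_integral_cong) (auto simp: indicator_def)
      then show ?thesis by (simp add: emeasure_eq_measure)
    qed
    have "(\<integral>\<^sup>+\<omega>. g (X t x \<omega>) \<partial>M) = 1 + (\<Sum>n. 2^n * ennreal (prob {\<omega>\<in>space M. X t x \<omega> \<notin> K n}))"
      unfolding g_def
      by (subst nn_integral_add) (simp_all add: nn_integral_suminf nn_integral_cmult ind emeasure_space_1)
    then have "ennreal (c t x) * (\<integral>\<^sup>+\<omega>. g (X t x \<omega>) \<partial>M)
        = ennreal (c t x) + (\<Sum>n. ennreal (c t x) * (2^n * ennreal (prob {\<omega>\<in>space M. X t x \<omega> \<notin> K n})))"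
      by (simp add: distrib_left)
    also have "\<dots> = ennreal (c t x) + (\<Sum>n. ennreal (2^n * (c t x * prob {\<omega>\<in>space M. X t x \<omega> \<notin> K n})))"
      using c by (simp add: ennreal_mult ennreal_power[symmetric] mult_ac del: ennreal_power)
    also have "\<dots> \<le> ennreal B + (\<Sum>n. ennreal ((B + 1) * (1/2)^n))"
    proof (intro add_mono suminf_le ennreal_leI cB t)
      fix n
      have "2^n * (c t x * prob {\<omega>\<in>space M. X t x \<omega> \<notin> K n}) \<le> 2^n * ((B + 1) * (1/4)^n)"
        by (intro mult_left_mono K(2) t) auto
      also have "\<dots> = (B + 1) * (2 * (1/4))^n" unfolding power_mult_distrib by simp
      also have "2 * (1/4) = (1/2::real)" by simp
      finally show "2^n * (c t x * prob {\<omega>\<in>space M. X t x \<omega> \<notin> K n}) \<le> (B + 1) * (1/2)^n" .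
    qed auto
    also have "(\<Sum>n. ennreal ((B + 1) * (1/2)^n)) = ennreal (2 * (B + 1))"
    proof (rule suminf_ennreal_eq)
      show "(\<lambda>n. (B + 1) * (1/2)^n) sums (2 * (B + 1))"
        using sums_mult[OF geometric_sums[of "1/2::real"], of "B + 1"] by (simp add: mult.commute)
    qed (use B in auto)
    also have "ennreal B + \<dots> = ennreal D" using B(1) by (simp add: D_def ennreal_plus[symmetric] del: ennreal_plus)
    finally show ?thesis .
  qed
  \<comment> \<open>The series in \<open>g\<close> diverges at points lying outside infinitely many
    \<open>K n\<close>; there the inverse is 0 and so is \<open>\<psi>\<close>.\<close>
  define \<psi> where "\<psi> y = complex_of_real (D * enn2real (inverse (g y)))" for y
  have \<psi>_le: "cmod (\<psi> y) \<le> D * r" if "r > 0" "ennreal (1/r) \<le> g y" for r y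
  proof -
    have "enn2real (inverse (g y)) \<le> r"
    proof (cases "g y")
      case (real G)
      then have G: "1 / r \<le> G" using that by (simp add: ennreal_le_iff)
      moreover have "0 < 1 / r" using that by simp
      ultimately have "0 < G" by linarith
      then show ?thesis using G that(1) real by (simp add: inverse_ennreal field_simps)
    qed (use that in simp)
    then show ?thesis using D by (simp add: \<psi>_def norm_mult)
  qed
  have "\<psi> \<in> strict_weights"
  proof (rule strict_weightsI)
    show "cmod (\<psi> y) \<le> D * 1" for y by (rule \<psi>_le) (auto simp: g_def)
  next
    fix e :: real assume e: "e > 0"
    then obtain n where n: "(1/2::real)^n < e / D"
      using real_arch_pow_inv[of "e/D" "1/2"] D by auto
    have "cmod (\<psi> y) \<le> e" if y: "y \<notin> K n" for y
    proof -
      have "ennreal (1 / (1/2)^n) = 2^n * indicator (- K n) y"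
        using y by (simp add: power_one_over ennreal_power[symmetric] del: ennreal_power)
      also have "\<dots> = (\<Sum>i\<in>{n}. 2^i * indicator (- K i) y)" by (subst sum.insert) simp_all
      also have "\<dots> \<le> (\<Sum>i. 2^i * indicator (- K i) y)"
        by (intro sum_le_suminf summableI) auto
      also have "\<dots> \<le> g y" by (simp add: g_def)
      finally have "cmod (\<psi> y) \<le> D * (1/2)^n" by (intro \<psi>_le) auto
      also have "\<dots> \<le> D * (e / D)" using n D by (intro mult_left_mono) auto
      finally show ?thesis using D by simp
    qed
    then show "\<exists>K. compact K \<and> (\<forall>y. y \<notin> K \<longrightarrow> cmod (\<psi> y) \<le> e)" using K(1) by blast
  qed
  moreover have "weighted_norm \<phi> (\<lambda>x. w t *\<^sub>R T t f x) \<le> weighted_norm \<psi> f"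
    if t: "t \<ge> 0" and f: "f \<in> Cb" for t f
  proof (rule weighted_norm_least, rule dense_ge)
    \<comment> \<open>The strict inequality gives \<open>r > 0\<close>. This matters where
      \<open>g\<close> is infinite: there \<open>\<psi>\<close> vanishes and does not control
      \<open>f\<close>, but \<open>ennreal r * g y\<close> is infinite.\<close>
    fix x r assume r: "weighted_norm \<psi> f < r"
    have up: "cmod (\<psi> y * f y) \<le> r" for y
      using weighted_norm_upper[OF \<open>\<psi> \<in> strict_weights\<close> f, of y] r by linarith
    have r0: "r > 0" using weighted_norm_nonneg[OF \<open>\<psi> \<in> strict_weights\<close> f] r by linarith
    note [measurable] = X_measurable[OF t] bcontfun_borel_measurable[OF f]
    have pt: "ennreal (D * cmod (f y)) \<le> ennreal r * g y" for y
    proof (cases "g y")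
      case (real G)
      have "1 \<le> g y" unfolding g_def by (rule order_trans[OF _ add_mono[OF order_refl zero_le]]) simp
      then have G: "G \<ge> 1" using real by simp
      then have "enn2real (inverse (g y)) = inverse G" using real by (simp add: inverse_ennreal)
      then have "D * inverse G * cmod (f y) \<le> r"
        using up[of y] D G by (simp add: \<psi>_def norm_mult norm_inverse)
      then have "D * cmod (f y) \<le> r * G" using G by (simp add: field_simps)
      then show ?thesis using r0 real by (simp add: ennreal_mult[symmetric] ennreal_leI)
    qed (use r0 in \<open>simp add: ennreal_mult_top\<close>)
    have "ennreal (D * cmod (\<phi> x * (w t *\<^sub>R T t f x))) = ennreal (c t x) * (ennreal D * ennreal (norm (T t f x)))"
      using c[of t x] D by (simp add: c_def norm_mult ennreal_mult[symmetric] mult_ac)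
    also have "\<dots> \<le> ennreal (c t x) * (ennreal D * (\<integral>\<^sup>+\<omega>. ennreal (norm (f (X t x \<omega>))) \<partial>M))"
      unfolding transition_operator_def using integrable_X[OF f t]
      by (intro mult_left_mono integral_norm_bound_ennreal) auto
    also have "\<dots> = ennreal (c t x) * (\<integral>\<^sup>+\<omega>. ennreal (D * cmod (f (X t x \<omega>))) \<partial>M)"
      using D by (simp add: ennreal_mult nn_integral_cmult)
    also have "\<dots> \<le> ennreal (c t x) * (\<integral>\<^sup>+\<omega>. ennreal r * g (X t x \<omega>) \<partial>M)"
      by (intro mult_left_mono nn_integral_mono pt) auto
    also have "\<dots> = ennreal r * (ennreal (c t x) * (\<integral>\<^sup>+\<omega>. g (X t x \<omega>) \<partial>M))"
      by (simp add: nn_integral_cmult mult_ac)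
    also have "\<dots> \<le> ennreal r * ennreal D" by (intro mult_left_mono gint t) auto
    finally have "D * cmod (\<phi> x * (w t *\<^sub>R T t f x)) \<le> D * r"
      using r0 D by (simp add: ennreal_mult[symmetric] ennreal_le_iff mult.commute)
    then show "cmod (\<phi> x * (w t *\<^sub>R T t f x)) \<le> r" using D by simp
  qed
  ultimately show ?thesis by blast
qed

lemma strict_equicontinuous_scaled:
  fixes w :: "real \<Rightarrow> real"
  assumes w: "\<And>t. t \<ge> 0 \<Longrightarrow> \<bar>w t\<bar> \<le> 1" "(w \<longlongrightarrow> 0) at_top"
  shows "strict_equicontinuous {\<lambda>f x. w t *\<^sub>R T t f x | t. t \<ge> 0}"
proof (rule strict_equicontinuousI)
  fix S assume "S \<in> {\<lambda>f x. w t *\<^sub>R T t f x | t. t \<ge> 0}"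
  then obtain t where t: "t \<ge> 0" and S: "S = (\<lambda>f x. complex_of_real (w t) * T t f x)"
    by (auto simp: scaleR_conv_of_real)
  show "S ` Cb \<subseteq> Cb" using t unfolding S by (auto intro: bcontfun_cmult transition_operator_Cb)
  show "linear_on_Cb S" using linear_transition_operator[OF t]
    by (auto simp: S linear_on_Cb_def algebra_simps)
qed (use dominating_weight[OF _ w] in blast)

lemma strict_equicontinuous_locally:
  assumes "t0 > 0"
  shows "strict_equicontinuous {T t | t. 0 \<le> t \<and> t \<le> t0}"
proof -
  define w where "w t = (if t \<le> t0 then 1 else 0 :: real)" for t
  have lim: "(w \<longlongrightarrow> 0) at_top"
    by (rule tendsto_eventually) (auto simp: w_def eventually_at_top_linorder intro!: exI[of _ "t0 + 1"])
  have "strict_equicontinuous {\<lambda>f x. w t *\<^sub>R T t f x | t. t \<ge> 0}"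
    by (rule strict_equicontinuous_scaled[OF _ lim]) (auto simp: w_def)
  moreover have "{T t | t. 0 \<le> t \<and> t \<le> t0} \<subseteq> {\<lambda>f x. w t *\<^sub>R T t f x | t. t \<ge> 0}"
  proof clarify
    fix t assume "0 \<le> t" "t \<le> t0"
    then show "\<exists>s. T t = (\<lambda>f x. w s *\<^sub>R T s f x) \<and> 0 \<le> s"
      by (intro exI[of _ t]) (auto simp: w_def)
  qed
  ultimately show ?thesis unfolding strict_equicontinuous_def by (meson subset_iff)
qed

lemma quasi_strict_equicontinuous_transition: "quasi_strict_equicontinuous T"
proof -
  have "strict_equicontinuous {\<lambda>f x. exp (- t) *\<^sub>R T t f x | t. t \<ge> 0}"
    by (rule strict_equicontinuous_scaled)
      (auto intro: filterlim_compose[OF exp_at_bot filterlim_uminus_at_bot_at_top])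
  then show ?thesis unfolding quasi_strict_equicontinuous_def by (intro exI[of _ 1]) simp
qed

text \<open>Joint continuity gives uniform closeness of \<open>T t f\<close> and
  \<open>T s f\<close> only on compact sets; off a large compact set the smallness of the weight
  compensates for the crude bound \<open>2 * B\<close>.\<close>

lemma strict_continuous_transition: "strict_continuous_family T"
  unfolding strict_continuous_family_def continuous_map
proof (intro ballI conjI allI impI)
  fix f :: "'e \<Rightarrow> complex" and U :: "('e \<Rightarrow> complex) set"
  assume f: "f \<in> Cb" and U: "openin strict_topology U"
  obtain B where B: "B > 0" "\<And>x. norm (f x) \<le> B" using bcontfun_normE[OF f] by blast
  have "\<exists>d>0. \<forall>t\<in>{0..}. dist t s < d \<longrightarrow> T t f \<in> U" if s: "s \<ge> 0" "T s f \<in> U" for s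
  proof -
    obtain \<phi> where \<phi>: "\<phi> \<in> strict_weights" "{g \<in> Cb. weighted_norm \<phi> (\<lambda>x. g x - T s f x) < 1} \<subseteq> U"
      by (rule openin_strict_topologyD[OF U s(2)])
    obtain L where L: "L > 0" "\<And>x. cmod (\<phi> x) \<le> L" using strict_weights_normE[OF \<phi>(1)] by blast
    \<comment> \<open>With this threshold the weighted difference off \<open>K\<close> is at most
      \<open>1 / (4 * B) * (2 * B) = 1/2\<close>; the modulus \<open>1 / (2 * L)\<close> below gives
      the same bound on \<open>K\<close>.\<close>
    obtain K where K: "compact K" "\<And>x. x \<notin> K \<Longrightarrow> cmod (\<phi> x) \<le> 1 / (4 * B)"
      using strict_weights_compactE[OF \<phi>(1), of "1 / (4 * B)"] B by auto
    \<comment> \<open>The time interval contains every nonnegative \<open>t\<close> within distance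
      1 of \<open>s\<close>, hence the \<open>min d 1\<close> later on.\<close>
    have "uniformly_continuous_on ({0..s + 1} \<times> K) (\<lambda>(t, x). T t f x)"
      unfolding transition_operator_def
      by (intro compact_uniformly_continuous compact_Times K compact_Icc
          continuous_on_subset[OF continuous_on_expectation[OF f]]) auto
    moreover have "1 / (2 * L) > 0" using L by simp
    ultimately obtain d where d: "d > 0"
      "\<And>z z'. z \<in> {0..s + 1} \<times> K \<Longrightarrow> z' \<in> {0..s + 1} \<times> K \<Longrightarrow> dist z' z < d \<Longrightarrow>
        dist ((\<lambda>(t, x). T t f x) z') ((\<lambda>(t, x). T t f x) z) < 1 / (2 * L)"
      unfolding uniformly_continuous_on_def by meson
    have "T t f \<in> U" if t: "t \<ge> 0" "dist t s < min d 1" for t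
    proof -
      have "weighted_norm \<phi> (\<lambda>x. T t f x - T s f x) \<le> 1/2"
      proof (rule weighted_norm_least)
        fix x
        show "cmod (\<phi> x * (T t f x - T s f x)) \<le> 1/2"
        proof (cases "x \<in> K")
          case True
          have "dist (T t f x) (T s f x) < 1 / (2 * L)"
            using d(2)[of "(s, x)" "(t, x)"] True t s by (auto simp: dist_Pair_Pair dist_real_def)
          then have "cmod (\<phi> x) * cmod (T t f x - T s f x) \<le> L * (1 / (2 * L))"
            using L by (intro mult_mono) (auto simp: dist_norm)
          then show ?thesis using L(1) by (simp add: norm_mult)
        next
          case False
          have "cmod (T t f x - T s f x) \<le> 2 * B"
            using norm_triangle_ineq4[of "T t f x" "T s f x"]
              norm_transition_operator_le[OF f t(1) B(2), of x]
              norm_transition_operator_le[OF f s(1) B(2), of x] by linarith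
          then have "cmod (\<phi> x) * cmod (T t f x - T s f x) \<le> 1 / (4 * B) * (2 * B)"
            using K(2)[OF False] B by (intro mult_mono) auto
          then show ?thesis using B(1) by (simp add: norm_mult)
        qed
      qed
      then show ?thesis using \<phi>(2) transition_operator_Cb[OF f t(1)] by auto
    qed
    then show ?thesis using d(1) by (intro exI[of _ "min d 1"]) auto
  qed
  then show "openin (top_of_set {0..}) {t \<in> topspace (top_of_set {0..}). T t f \<in> U}"
    unfolding openin_euclidean_subtopology_iff by auto
qed (auto intro: transition_operator_Cb)

end


section \<open>Regularity, total variation and Jordan decomposition\<close>

text \<open>Induction over the Borel sets generated by the closed ones. A closed set is the
  intersection of its metric neighbourhoods, and complementation exchanges the inner and the outer
  set.\<close>

lemma finite_measure_closed_open_regular: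
  fixes N :: "'a::metric_space measure"
  assumes "finite_measure N" and sets: "sets N = sets borel" and A: "A \<in> sets borel" and e: "e > 0"
  shows "\<exists>F U. closed F \<and> open U \<and> F \<subseteq> A \<and> A \<subseteq> U \<and> measure N (U - F) < e"
proof -
  interpret finite_measure N by fact
  have sp: "space N = UNIV" using sets_eq_imp_space_eq[OF sets] by simp
  have "A \<in> sigma_sets UNIV (Collect closed)" using A by (simp add: borel_eq_closed)
  then show ?thesis using e
  proof (induction arbitrary: e)
    case (Basic A)
    then have A: "closed A" by simp
    show ?case
    \<comment> \<open>For empty \<open>A\<close> the convention for \<open>infdist\<close> would
      make every \<open>U n\<close> the whole space.\<close>
    proof (cases "A = {}")
      case False
      define U where "U n = {y. infdist y A < 1 / real (Suc n)}" for n
      have opn: "open (U n)" for n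
        unfolding U_def by (intro open_Collect_less continuous_intros)
      have "(\<lambda>n. measure N (U n - A)) \<longlonglongrightarrow> measure N (\<Inter>n. U n - A)"
      proof (rule finite_Lim_measure_decseq)
        show "range (\<lambda>n. U n - A) \<subseteq> sets N" using opn A by (auto simp: sets)
        have "U (Suc n) \<subseteq> U n" for n
        proof
          fix y assume "y \<in> U (Suc n)"
          moreover have "1 / real (Suc (Suc n)) \<le> 1 / real (Suc n)" by (simp add: frac_le)
          ultimately show "y \<in> U n" unfolding U_def by (blast intro: less_le_trans)
        qed
        then show "decseq (\<lambda>n. U n - A)" by (intro decseq_SucI) blast
      qed
      moreover have "(\<Inter>n. U n - A) = {}"
      proof -
        have "y \<in> A" if "\<And>n. y \<in> U n" for y
        proof -
          have "infdist y A \<le> 0"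
          proof (rule ccontr)
            assume "\<not> infdist y A \<le> 0"
            then obtain n where "1 / real (Suc n) < infdist y A"
              using nat_approx_posE[of "infdist y A"] by auto
            then show False using that[of n] by (simp add: U_def)
          qed
          then show ?thesis
            using in_closed_iff_infdist_zero[OF A False, of y] infdist_nonneg[of y A] by linarith
        qed
        then have "(\<Inter>n. U n) \<subseteq> A" by blast
        then show ?thesis by auto
      qed
      ultimately have "(\<lambda>n. measure N (U n - A)) \<longlonglongrightarrow> 0" by (simp only: measure_empty)
      then obtain n where n: "measure N (U n - A) < e"
        using order_tendstoD(2)[OF _ Basic(2)] by (metis (lifting) eventually_sequentially order_refl)
      moreover have "A \<subseteq> U n" by (auto simp: U_def)
      ultimately show ?thesis using opn A by blast
    qed (use Basic(2) in \<open>auto intro!: exI[of _ "{}"]\<close>)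
  next
    case Empty
    then show ?case by (intro exI[of _ "{}"]) auto
  next
    case (Compl A)
    from Compl.IH[OF Compl.prems] obtain F U where
      "closed F" "open U" "F \<subseteq> A" "A \<subseteq> U" "measure N (U - F) < e" by blast
    moreover have "- F - - U = U - F" by auto
    ultimately show ?case by (intro exI[of _ "- U"] exI[of _ "- F"]) auto
  next
    case (Union A)
    have "\<exists>F U. closed F \<and> open U \<and> F \<subseteq> A i \<and> A i \<subseteq> U \<and> measure N (U - F) < e/2 * (1/2)^Suc i" for i
      using Union.IH[of "e/2 * (1/2)^Suc i" i] Union.prems by simp
    then obtain F U where FU: "\<And>i. closed (F i)" "\<And>i. open (U i)" "\<And>i. F i \<subseteq> A i" "\<And>i. A i \<subseteq> U i"
      "\<And>i. measure N (U i - F i) < e/2 * (1/2)^Suc i" by metis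
    have ms[simp]: "F i \<in> sets N" "U i \<in> sets N" for i using FU(1,2) by (auto simp: sets)
    have sums: "(\<lambda>i. e/2 * (1/2)^Suc i) sums (e/2)" using sums_mult[OF power_half_series, of "e/2"] by simp
    have summ: "summable (\<lambda>i. measure N (U i - F i))"
      by (rule summable_comparison_test'[OF sums_summable[OF sums], of 0])
        (use FU(5) in \<open>auto intro: less_imp_le\<close>)
    have "measure N ((\<Union>i. U i) - (\<Union>i. F i)) \<le> measure N (\<Union>i. U i - F i)"
      by (intro finite_measure_mono sets.countable_UN') auto
    also have "\<dots> \<le> (\<Sum>i. measure N (U i - F i))"
      by (rule finite_measure_subadditive_countably[OF _ summ]) auto
    also have "\<dots> \<le> (\<Sum>i. e/2 * (1/2)^Suc i)"
      using FU(5) by (intro suminf_le summ sums_summable[OF sums] less_imp_le)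
    also have "\<dots> = e/2" using sums by (rule sums_unique[symmetric])
    also have "\<dots> < e" using Union.prems by simp
    finally have lt: "measure N ((\<Union>i. U i) - (\<Union>i. F i)) < e" .
    \<comment> \<open>An infinite union of closed sets need not be closed, so the inner set is cut
      off at a finite stage; the strict bound \<open>lt\<close> survives for large
      \<open>n\<close>.\<close>
    have "(\<lambda>n. measure N ((\<Union>i. U i) - (\<Union>i<n. F i))) \<longlonglongrightarrow> measure N (\<Inter>n. (\<Union>i. U i) - (\<Union>i<n. F i))"
    proof (rule finite_Lim_measure_decseq)
      show "range (\<lambda>n. (\<Union>i. U i) - (\<Union>i<n. F i)) \<subseteq> sets N"
        by (auto intro!: sets.Diff sets.countable_UN')
      show "decseq (\<lambda>n. (\<Union>i. U i) - (\<Union>i<n. F i))" by (intro decseq_SucI) auto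
    qed
    moreover have "(\<Inter>n. (\<Union>i. U i) - (\<Union>i<n. F i)) = (\<Union>i. U i) - (\<Union>i. F i)" by auto
    ultimately obtain n where n: "measure N ((\<Union>i. U i) - (\<Union>i<n. F i)) < e"
      using order_tendstoD(2)[OF _ lt] by (metis (lifting) eventually_sequentially order_refl)
    have "closed (\<Union>i<n. F i)" using FU(1) by auto
    moreover have "open (\<Union>i. U i)" using FU(2) by auto
    moreover have "(\<Union>i<n. F i) \<subseteq> (\<Union>i. A i)" "(\<Union>i. A i) \<subseteq> (\<Union>i. U i)" using FU(3,4) by blast+
    ultimately show ?case using n by blast
  qed
qed

text \<open>Intersecting the inner closed set with one compact set of nearly full mass upgrades
  closed approximation to compact approximation.\<close>

lemma tight_imp_compact_inner_regular:
  fixes N :: "'a::metric_space measure"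
  assumes N: "finite_measure N" "sets N = sets borel"
    and tight: "\<And>e. e > 0 \<Longrightarrow> \<exists>K. compact K \<and> measure N (- K) < e"
    and A: "A \<in> sets borel" and e: "e > 0"
  shows "\<exists>K. compact K \<and> K \<subseteq> A \<and> measure N (A - K) < e"
proof -
  interpret finite_measure N by fact
  obtain F U where F: "closed F" "open U" "F \<subseteq> A" "A \<subseteq> U" "measure N (U - F) < e/2"
    using finite_measure_closed_open_regular[OF N A, of "e/2"] e by auto
  obtain K where K: "compact K" "measure N (- K) < e/2" using tight[of "e/2"] e by auto
  have ms: "F \<in> sets N" "U \<in> sets N" "K \<in> sets N" "A \<in> sets N"
    using F K A N(2) by (auto simp: compact_imp_closed)
  have mK: "- K \<in> sets N" using K(1) N(2) by (simp add: compact_imp_closed)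
  have "measure N (A - (F \<inter> K)) \<le> measure N ((U - F) \<union> - K)"
    using ms mK F(4) by (intro finite_measure_mono) auto
  also have "\<dots> \<le> measure N (U - F) + measure N (- K)"
    using ms mK by (intro measure_Un_le) auto
  also have "\<dots> < e" using F K by linarith
  finally show ?thesis
    using closed_Int_compact[OF F(1) K(1)] F(3) by (intro exI[of _ "F \<inter> K"]) auto
qed

text \<open>The codomain is general so that complex measures and their real and imaginary parts
  share the same facts.\<close>

definition set_additive :: "('a::topological_space set \<Rightarrow> 'b::real_normed_vector) \<Rightarrow> bool" where
  "set_additive \<mu> \<longleftrightarrow>
     (\<forall>A::nat \<Rightarrow> 'a set. range A \<subseteq> sets borel \<longrightarrow> disjoint_family A \<longrightarrow>
        (\<lambda>n. \<mu> (A n)) sums \<mu> (\<Union>n. A n))"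

lemma set_additiveD:
  assumes "set_additive \<mu>" "range A \<subseteq> sets borel" "disjoint_family A"
  shows "(\<lambda>n. \<mu> (A n)) sums \<mu> (\<Union>n. A n)"
  using assms by (simp add: set_additive_def)

lemma set_additive_empty:
  assumes "set_additive \<mu>"
  shows "\<mu> {} = 0"
proof -
  have "(\<lambda>n::nat. \<mu> {}) sums \<mu> (\<Union>n::nat. {})"
    using assms by (intro set_additiveD) (auto simp: disjoint_family_on_def)
  then have "(\<lambda>n::nat. \<mu> {}) \<longlonglongrightarrow> 0" by (intro summable_LIMSEQ_zero) (simp add: sums_iff)
  then show ?thesis by (simp add: LIMSEQ_const_iff)
qed

lemma set_additive_Un:
  assumes "set_additive \<mu>" "A \<in> sets borel" "B \<in> sets borel" "A \<inter> B = {}"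
  shows "\<mu> (A \<union> B) = \<mu> A + \<mu> B"
proof -
  have "(\<lambda>n. \<mu> (binaryset A B n)) sums \<mu> (\<Union>n. binaryset A B n)"
    using assms
    by (intro set_additiveD) (auto simp: range_binaryset_eq disjoint_family_on_def binaryset_def)
  moreover have "(\<lambda>n. \<mu> (binaryset A B n)) sums (\<mu> A + \<mu> B)"
    using set_additive_empty[OF assms(1)] by (rule binaryset_sums)
  ultimately show ?thesis by (simp add: UN_binaryset_eq sums_unique2)
qed

lemma set_additive_Diff:
  assumes "set_additive \<mu>" "A \<in> sets borel" "B \<in> sets borel" "B \<subseteq> A"
  shows "\<mu> A = \<mu> B + \<mu> (A - B)"
  using set_additive_Un[OF assms(1), of B "A - B"] assms by (simp add: Un_absorb1)

lemma set_additive_uminus: "set_additive \<mu> \<Longrightarrow> set_additive (\<lambda>A. - \<mu> A)"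
  by (simp add: set_additive_def sums_minus)

lemma complex_measure_iff: "complex_measure \<mu> \<longleftrightarrow> set_additive \<mu>"
  by (simp add: complex_measure_def set_additive_def)

lemma set_additive_Re: "set_additive \<mu> \<Longrightarrow> set_additive (\<lambda>A. Re (\<mu> A))"
  by (simp add: set_additive_def sums_Re)

lemma set_additive_Im: "set_additive \<mu> \<Longrightarrow> set_additive (\<lambda>A. Im (\<mu> A))"
  by (simp add: set_additive_def sums_Im)

lemma SUP_add_le_ennreal:
  fixes f :: "'i \<Rightarrow> ennreal" and g :: "'j \<Rightarrow> ennreal"
  assumes "\<And>i j. i \<in> I \<Longrightarrow> j \<in> J \<Longrightarrow> f i + g j \<le> c" "I \<noteq> {}" "J \<noteq> {}"
  shows "(SUP i\<in>I. f i) + (SUP j\<in>J. g j) \<le> c"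
  using assms by (simp add: ennreal_SUP_add_left[symmetric] ennreal_SUP_add_right SUP_le_iff)

lemma ennreal_add_le: "ennreal (a + b) \<le> ennreal a + ennreal b"
proof -
  have "ennreal (a + b) \<le> ennreal (max 0 a + max 0 b)" by (intro ennreal_leI) auto
  also have "\<dots> = ennreal (max 0 a) + ennreal (max 0 b)" by (intro ennreal_plus) auto
  also have "\<dots> = ennreal a + ennreal b" by (simp add: ennreal_max_0)
  finally show ?thesis .
qed

text \<open>Only an inequality, because \<open>ennreal\<close> sends negative terms to 0. It
  supplies the countable subadditivity of the upper variation.\<close>

lemma ennreal_sums_le:
  assumes "f sums s"
  shows "ennreal s \<le> (\<Sum>i. ennreal (f i))"
proof (rule LIMSEQ_le_const2)
  show "(\<lambda>n. ennreal (\<Sum>i<n. f i)) \<longlonglongrightarrow> ennreal s"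
    using assms by (intro tendsto_ennrealI) (simp add: sums_def)
  have "ennreal (\<Sum>i<n. f i) \<le> (\<Sum>i<n. ennreal (f i))" for n
    by (induction n) (auto intro: order_trans[OF ennreal_add_le] add_mono)
  then show "\<exists>N. \<forall>n\<ge>N. ennreal (\<Sum>i<n. f i) \<le> (\<Sum>i. ennreal (f i))"
    by (meson order_trans sum_le_suminf summableI finite_lessThan zero_le)
qed

section \<open>Upper variation and Jordan decomposition\<close>

lemma sets_upper_variation [simp]: "sets (upper_variation \<nu>) = sets borel"
  using sets.sigma_sets_eq[of "borel :: 'a measure"] by (simp add: upper_variation_def)

lemma space_upper_variation [simp]: "space (upper_variation \<nu>) = UNIV"
  using sets_eq_imp_space_eq[OF sets_upper_variation[of \<nu>]] by simp

text \<open>\<open>measure_of\<close> takes the prescribed values only once these are known to be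
  countably additive. One inequality comes from superadditivity on disjoint pairs, the other from
  cutting a competitor \<open>B\<close> along the sets \<open>A i\<close>.\<close>

lemma emeasure_upper_variation:
  assumes \<nu>: "set_additive \<nu>" and A: "A \<in> sets borel"
  shows "emeasure (upper_variation \<nu>) A = (SUP B\<in>{B. B \<in> sets borel \<and> B \<subseteq> A}. ennreal (\<nu> B))"
proof -
  define u where "u A = (SUP B\<in>{B. B \<in> sets borel \<and> B \<subseteq> A}. ennreal (\<nu> B))" for A
  have upper: "ennreal (\<nu> B) \<le> u A" if "B \<in> sets borel" "B \<subseteq> A" for A B
    unfolding u_def using that by (intro SUP_upper) auto
  have mono: "u A \<le> u B" if "A \<subseteq> B" for A B
    unfolding u_def using that by (intro SUP_subset_mono) auto
  have u0: "u {} = 0"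
    unfolding u_def using set_additive_empty[OF \<nu>] by (intro antisym SUP_least) auto
  have super: "u A + u B \<le> u (A \<union> B)" if "A \<inter> B = {}" for A B
    unfolding u_def[of A] u_def[of B]
  proof (rule SUP_add_le_ennreal)
    fix C D assume C: "C \<in> {C. C \<in> sets borel \<and> C \<subseteq> A}" and D: "D \<in> {D. D \<in> sets borel \<and> D \<subseteq> B}"
    \<comment> \<open>A set of negative value contributes 0 after \<open>ennreal\<close>, so it is
      dropped rather than united with the other set, where it would lower the value.\<close>
    consider "\<nu> C \<le> 0" | "\<nu> D \<le> 0" | "\<nu> C \<ge> 0" "\<nu> D \<ge> 0" by linarith
    then show "ennreal (\<nu> C) + ennreal (\<nu> D) \<le> u (A \<union> B)"
    proof cases
      case 1
      then show ?thesis using D upper[of D "A \<union> B"] by (simp add: ennreal_neg le_supI2)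
    next
      case 2
      then show ?thesis using C upper[of C "A \<union> B"] by (simp add: ennreal_neg le_supI1)
    next
      case 3
      then have "ennreal (\<nu> C) + ennreal (\<nu> D) = ennreal (\<nu> (C \<union> D))"
        using C D that by (subst set_additive_Un[OF \<nu>]) (auto simp: ennreal_plus)
      then show ?thesis using C D upper[of "C \<union> D" "A \<union> B"] by auto
    qed
  qed auto
  have "emeasure (measure_of UNIV (sets borel) u) A = u A"
  proof (rule emeasure_measure_of_sigma[OF _ _ _ A])
    show "sigma_algebra UNIV (sets (borel :: 'a measure))"
      using sets.sigma_algebra_axioms[of "borel :: 'a measure"] by simp
    show "positive (sets borel) u" using u0 by (simp add: positive_def)
    show "countably_additive (sets borel) u"
      unfolding countably_additive_def
    proof (intro allI impI antisym)
      fix A :: "nat \<Rightarrow> 'a set"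
      assume A: "range A \<subseteq> sets borel" "disjoint_family A" "(\<Union>i. A i) \<in> sets borel"
      have "(\<Sum>i<n. u (A i)) \<le> u (\<Union>i<n. A i)" for n
      proof (induction n)
        case (Suc n)
        have disj: "A n \<inter> (\<Union>i<n. A i) = {}"
          using A(2) by (auto simp: disjoint_family_on_def) (metis disjoint_iff less_irrefl)
        have "(\<Sum>i<Suc n. u (A i)) \<le> u (A n) + u (\<Union>i<n. A i)"
          using Suc by (simp add: add.commute add_left_mono)
        also have "\<dots> \<le> u (A n \<union> (\<Union>i<n. A i))" by (rule super[OF disj])
        finally show ?case by (simp add: lessThan_Suc)
      qed (simp add: u0)
      also have "u (\<Union>i<n. A i) \<le> u (\<Union>i. A i)" for n by (intro mono) auto
      finally show "(\<Sum>i. u (A i)) \<le> u (\<Union>i. A i)"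
        by (auto simp: suminf_eq_SUP intro: SUP_least)
      show "u (\<Union>i. A i) \<le> (\<Sum>i. u (A i))"
        unfolding u_def[of "\<Union>i. A i"]
      proof (rule SUP_least, clarify)
        fix B assume B: "B \<in> sets borel" "B \<subseteq> (\<Union>i. A i)"
        have "(\<lambda>i. \<nu> (B \<inter> A i)) sums \<nu> (\<Union>i. B \<inter> A i)"
          using A B by (intro set_additiveD[OF \<nu>]) (auto simp: disjoint_family_on_def)
        moreover have "(\<Union>i. B \<inter> A i) = B" using B by auto
        ultimately have "ennreal (\<nu> B) \<le> (\<Sum>i. ennreal (\<nu> (B \<inter> A i)))"
          using ennreal_sums_le by fastforce
        also have "\<dots> \<le> (\<Sum>i. u (A i))" using A B by (intro suminf_le upper) auto
        finally show "ennreal (\<nu> B) \<le> (\<Sum>i. u (A i))" .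
      qed
    qed
  qed
  then show ?thesis by (simp only: upper_variation_def u_def[abs_def])
qed

lemma emeasure_upper_variation_le:
  assumes "set_additive \<nu>" "A \<in> sets borel" "\<And>B. B \<in> sets borel \<Longrightarrow> B \<subseteq> A \<Longrightarrow> \<nu> B \<le> c"
  shows "emeasure (upper_variation \<nu>) A \<le> ennreal c"
  using assms by (auto simp: emeasure_upper_variation intro!: SUP_least ennreal_leI)

lemma finite_measure_upper_variation:
  assumes "set_additive \<nu>" "\<And>B. B \<in> sets borel \<Longrightarrow> \<nu> B \<le> c"
  shows "finite_measure (upper_variation \<nu>)"
proof
  have "emeasure (upper_variation \<nu>) UNIV \<le> ennreal c"
    using assms by (intro emeasure_upper_variation_le) auto
  then show "emeasure (upper_variation \<nu>) (space (upper_variation \<nu>)) \<noteq> \<infinity>"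
    by (auto simp: top_unique)
qed

text \<open>For \<open>B \<subseteq> A\<close> one has
  \<open>\<nu> B = \<nu> A - \<nu> (A - B)\<close>, at most \<open>\<nu> A\<close> plus the lower
  variation of \<open>A\<close>. The supremum over \<open>B\<close> gives one inequality, and the
  same argument for \<open>- \<nu>\<close> the other.\<close>

lemma Jordan_decomposition:
  assumes \<nu>: "set_additive \<nu>" "\<And>B. B \<in> sets borel \<Longrightarrow> \<bar>\<nu> B\<bar> \<le> c" and A: "A \<in> sets borel"
  shows "\<nu> A = measure (upper_variation \<nu>) A - measure (upper_variation (\<lambda>A. - \<nu> A)) A"
proof -
  have le: "measure (upper_variation \<nu>) A \<le> \<nu> A + measure (upper_variation (\<lambda>A. - \<nu> A)) A"
    if \<nu>: "set_additive \<nu>" "\<And>B. B \<in> sets borel \<Longrightarrow> \<bar>\<nu> B\<bar> \<le> c" for \<nu>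
  proof -
    note \<nu>' = set_additive_uminus[OF \<nu>(1)]
    interpret p: finite_measure "upper_variation \<nu>"
      using \<nu> by (intro finite_measure_upper_variation[of _ c]) (auto simp: abs_le_iff)
    interpret n: finite_measure "upper_variation (\<lambda>A. - \<nu> A)"
      using \<nu>(2) by (intro finite_measure_upper_variation[OF \<nu>', of c]) (auto simp: abs_le_iff)
    have up: "- \<nu> B \<le> measure (upper_variation (\<lambda>A. - \<nu> A)) A" if "B \<in> sets borel" "B \<subseteq> A" for B
    proof -
      have "ennreal (- \<nu> B) \<le> emeasure (upper_variation (\<lambda>A. - \<nu> A)) A"
        unfolding emeasure_upper_variation[OF \<nu>' A] using that by (intro SUP_upper) auto
      then show ?thesis by (simp add: n.emeasure_eq_measure)
    qed
    have "emeasure (upper_variation \<nu>) A \<le> ennreal (\<nu> A + measure (upper_variation (\<lambda>A. - \<nu> A)) A)"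
    proof (rule emeasure_upper_variation_le[OF \<nu>(1) A])
      fix B assume B: "B \<in> sets borel" "B \<subseteq> A"
      then show "\<nu> B \<le> \<nu> A + measure (upper_variation (\<lambda>A. - \<nu> A)) A"
        using set_additive_Diff[OF \<nu>(1) A B] up[of "A - B"] A by auto
    qed
    \<comment> \<open>Taking \<open>B = A\<close> in \<open>up\<close> shows that the real number
      under \<open>ennreal\<close> is nonnegative, so the inequality can be read off in the
      reals.\<close>
    then show ?thesis using up[OF A order_refl] by (simp add: p.emeasure_eq_measure)
  qed
  have "measure (upper_variation (\<lambda>A. - \<nu> A)) A \<le> - \<nu> A + measure (upper_variation \<nu>) A"
    using le[OF set_additive_uminus[OF \<nu>(1)]] \<nu>(2) by simp
  then show ?thesis using le[OF \<nu>] by linarith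
qed

text \<open>The additive form of an equality of differences: \<open>M1 - N1 = N2 - M2\<close> is
  rearranged to involve sums only, since subtraction is unsuitable in
  \<open>ennreal\<close>.\<close>

lemma nn_integral_add_measures_cong:
  assumes s: "sets M1 = sets M" "sets M2 = sets M" "sets N1 = sets M" "sets N2 = sets M"
    and eq: "\<And>A. A \<in> sets M \<Longrightarrow> emeasure M1 A + emeasure M2 A = emeasure N1 A + emeasure N2 A"
    and f: "f \<in> borel_measurable M"
  shows "(\<integral>\<^sup>+x. f x \<partial>M1) + (\<integral>\<^sup>+x. f x \<partial>M2) = (\<integral>\<^sup>+x. f x \<partial>N1) + (\<integral>\<^sup>+x. f x \<partial>N2)"
  using f
proof (induction rule: borel_measurable_induct)
  note [measurable_cong] = s and sp = s[THEN sets_eq_imp_space_eq]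
  case (cong f g)
  have "integral\<^sup>N L f = integral\<^sup>N L g" if "space L = space M" for L
    using cong(3) that by (intro nn_integral_cong) auto
  then show ?case using cong(4) by (simp add: sp)
next
  note [measurable_cong] = s
  case (set A)
  then show ?case using eq[of A] by (simp add: s)
next
  note [measurable_cong] = s
  case (mult u c)
  then show ?case by (simp add: nn_integral_cmult flip: distrib_left)
next
  note [measurable_cong] = s
  case (add u v)
  then show ?case by (simp add: nn_integral_add algebra_simps)
next
  note [measurable_cong] = s
  case (seq U)
  have mono: "incseq (\<lambda>i. \<integral>\<^sup>+x. U i x \<partial>L)" for L
    using seq(3) by (auto simp: incseq_def le_fun_def intro!: nn_integral_mono)
  have conv: "(\<integral>\<^sup>+x. (SUP i. U i) x \<partial>L) = (SUP i. \<integral>\<^sup>+x. U i x \<partial>L)" if "sets L = sets M" for L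
    unfolding SUP_apply using seq(1,3) that
    by (intro nn_integral_monotone_convergence_SUP) (auto cong: measurable_cong_sets)
  show ?case
    unfolding conv[OF s(1)] conv[OF s(2)] conv[OF s(3)] conv[OF s(4)]
    using seq.IH by (simp add: ennreal_SUP_add[OF mono mono, symmetric])
qed

lemma integral_add_measures_cong:
  fixes f :: "'a \<Rightarrow> complex"
  assumes fin: "finite_measure M1" "finite_measure M2" "finite_measure N1" "finite_measure N2"
    and s: "sets M1 = sets M" "sets M2 = sets M" "sets N1 = sets M" "sets N2 = sets M"
    and eq: "\<And>A. A \<in> sets M \<Longrightarrow> measure M1 A + measure M2 A = measure N1 A + measure N2 A"
    and f: "f \<in> borel_measurable M" "\<And>x. norm (f x) \<le> B"
  shows "(\<integral>x. f x \<partial>M1) + (\<integral>x. f x \<partial>M2) = (\<integral>x. f x \<partial>N1) + (\<integral>x. f x \<partial>N2)"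
proof -
  note [measurable_cong] = s
  note fin' = fin[THEN finite_measure.emeasure_eq_measure]
  have eq': "emeasure M1 A + emeasure M2 A = emeasure N1 A + emeasure N2 A" if "A \<in> sets M" for A
    using eq[OF that] by (simp add: fin' flip: ennreal_plus)
  have int: "integrable L g" if "finite_measure L" "sets L = sets M" "g \<in> borel_measurable M"
    "\<And>x. norm (g x) \<le> C" for L C and g :: "'a \<Rightarrow> 'c::{banach, second_countable_topology}"
  proof -
    interpret finite_measure L by fact
    show ?thesis
      using that by (intro integrable_const_bound[of _ C]) (auto cong: measurable_cong_sets)
  qed
  have pos: "(\<integral>x. g x \<partial>M1) + (\<integral>x. g x \<partial>M2) = (\<integral>x. g x \<partial>N1) + (\<integral>x. g x \<partial>N2)"
    if g: "g \<in> borel_measurable M" "\<And>x. \<bar>g x\<bar> \<le> C" "\<And>x. 0 \<le> g x" for g :: "'a \<Rightarrow> real" and C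
  proof -
    have "ennreal (\<integral>x. g x \<partial>L) = (\<integral>\<^sup>+x. g x \<partial>L)" if "finite_measure L" "sets L = sets M" for L
      using int[OF that g(1), of C] g(2,3) by (intro nn_integral_eq_integral[symmetric]) auto
    note nn = this[OF fin(1) s(1)] this[OF fin(2) s(2)] this[OF fin(3) s(3)] this[OF fin(4) s(4)]
    have "(\<integral>\<^sup>+x. g x \<partial>M1) + (\<integral>\<^sup>+x. g x \<partial>M2) = (\<integral>\<^sup>+x. g x \<partial>N1) + (\<integral>\<^sup>+x. g x \<partial>N2)"
      using g(1) by (intro nn_integral_add_measures_cong[OF s eq']) auto
    then show ?thesis using g(3) by (simp add: nn[symmetric] flip: ennreal_plus)
  qed
  have real: "(\<integral>x. g x \<partial>M1) + (\<integral>x. g x \<partial>M2) = (\<integral>x. g x \<partial>N1) + (\<integral>x. g x \<partial>N2)"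
    if g: "g \<in> borel_measurable M" "\<And>x. \<bar>g x\<bar> \<le> C" for g :: "'a \<Rightarrow> real" and C
  proof -
    have C: "0 \<le> C" using g(2) order_trans[OF abs_ge_zero] by blast
    have "\<bar>g x + C\<bar> \<le> 2 * C" "0 \<le> g x + C" for x using g(2)[of x] by (auto simp: abs_le_iff)
    \<comment> \<open>Shifting by \<open>C\<close> makes the integrand nonnegative; the constant
      itself is another instance of \<open>pos\<close> and is subtracted afterwards.\<close>
    then have a: "(\<integral>x. g x + C \<partial>M1) + (\<integral>x. g x + C \<partial>M2) = (\<integral>x. g x + C \<partial>N1) + (\<integral>x. g x + C \<partial>N2)"
      using g(1) by (intro pos[of _ "2 * C"]) auto
    have c: "(\<integral>x. C \<partial>M1) + (\<integral>x. C \<partial>M2) = (\<integral>x. C \<partial>N1) + (\<integral>x. C \<partial>N2)"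
      using C by (intro pos[of _ C]) auto
    have "(\<integral>x. g x + C \<partial>L) = (\<integral>x. g x \<partial>L) + (\<integral>x. C \<partial>L)" if "finite_measure L" "sets L = sets M" for L
      using int[OF that g(1), of C] int[OF that, of "\<lambda>_. C" "\<bar>C\<bar>"] g(2)
      by (intro Bochner_Integration.integral_add) auto
    note ad = this[OF fin(1) s(1)] this[OF fin(2) s(2)] this[OF fin(3) s(3)] this[OF fin(4) s(4)]
    show ?thesis using a c unfolding ad by linarith
  qed
  have fi: "integrable L f" if "finite_measure L" "sets L = sets M" for L
    using int[OF that f] .
  note fi = fi[OF fin(1) s(1)] fi[OF fin(2) s(2)] fi[OF fin(3) s(3)] fi[OF fin(4) s(4)]
  have "\<bar>Re (f x)\<bar> \<le> B" "\<bar>Im (f x)\<bar> \<le> B" for x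
    using f(2)[of x] abs_Re_le_cmod[of "f x"] abs_Im_le_cmod[of "f x"] by linarith+
  then have "(\<integral>x. Re (f x) \<partial>M1) + (\<integral>x. Re (f x) \<partial>M2) = (\<integral>x. Re (f x) \<partial>N1) + (\<integral>x. Re (f x) \<partial>N2)"
    "(\<integral>x. Im (f x) \<partial>M1) + (\<integral>x. Im (f x) \<partial>M2) = (\<integral>x. Im (f x) \<partial>N1) + (\<integral>x. Im (f x) \<partial>N2)"
    using f(1) by (auto intro!: real[of _ B])
  then show ?thesis using fi by (simp add: complex_eq_iff)
qed

text \<open>The integral does not depend on the chosen difference of finite measures. This is
  required because the kernel images of two mutually singular measures need not be mutually
  singular.\<close>

lemma signed_integral_eq_diff:
  fixes N1 N2 :: "'a::metric_space measure"
  assumes fin: "finite_measure N1" "finite_measure N2"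
    and s: "sets N1 = sets borel" "sets N2 = sets borel"
    and \<nu>: "set_additive \<nu>" "\<And>A. A \<in> sets borel \<Longrightarrow> \<nu> A = measure N1 A - measure N2 A"
    and f: "f \<in> Cb"
  shows "signed_integral \<nu> f = (\<integral>x. f x \<partial>N1) - (\<integral>x. f x \<partial>N2)"
proof -
  interpret N1: finite_measure N1 by fact
  interpret N2: finite_measure N2 by fact
  define c where "c = measure N1 (space N1) + measure N2 (space N2)"
  have c: "\<bar>\<nu> B\<bar> \<le> c" if "B \<in> sets borel" for B
    using \<nu>(2)[OF that] N1.bounded_measure[of B] N2.bounded_measure[of B]
      measure_nonneg[of N1 B] measure_nonneg[of N2 B] unfolding c_def by linarith
  have fin': "finite_measure (upper_variation \<nu>)" "finite_measure (upper_variation (\<lambda>A. - \<nu> A))"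
    using c by (intro finite_measure_upper_variation[of _ c] \<nu> set_additive_uminus; force simp: abs_le_iff)+
  obtain B where B: "\<And>x. norm (f x) \<le> B" using bcontfun_normE[OF f] by blast
  have "(\<integral>x. f x \<partial>upper_variation \<nu>) + (\<integral>x. f x \<partial>N2)
      = (\<integral>x. f x \<partial>upper_variation (\<lambda>A. - \<nu> A)) + (\<integral>x. f x \<partial>N1)"
  proof (rule integral_add_measures_cong[OF fin'(1) fin(2) fin'(2) fin(1) _ s(2) _ s(1)])
    fix A :: "'a set" assume A: "A \<in> sets borel"
    show "measure (upper_variation \<nu>) A + measure N2 A
        = measure (upper_variation (\<lambda>A. - \<nu> A)) A + measure N1 A"
      using Jordan_decomposition[OF \<nu>(1) c A] \<nu>(2)[OF A] by linarith
  qed (use B bcontfun_borel_measurable[OF f] in auto)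
  then show ?thesis by (simp add: signed_integral_def algebra_simps)
qed

section \<open>Total variation and Radon complex measures\<close>

lemma sum_le_total_variation:
  assumes "finite I" "disjoint_family_on B I" "\<And>i. i \<in> I \<Longrightarrow> B i \<in> sets borel" "\<mu> {} = 0"
  shows "(\<Sum>i\<in>I. ennreal (cmod (\<mu> (B i)))) \<le> total_variation \<mu> (\<Union>i\<in>I. B i)"
proof -
  have "(\<Sum>i\<in>I. ennreal (cmod (\<mu> (B i)))) = (\<Sum>C\<in>B ` I. ennreal (cmod (\<mu> C)))"
  \<comment> \<open>A disjoint family can repeat only the empty set, whose terms vanish.\<close>
  proof (subst sum.reindex_nontrivial[OF assms(1)])
    fix i j assume ij: "i \<in> I" "j \<in> I" "i \<noteq> j" "B i = B j"
    then have "B i = {}" using assms(2) by (auto simp: disjoint_family_on_def)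
    then show "ennreal (cmod (\<mu> (B i))) = 0" using assms(4) by simp
  qed simp
  also have "\<dots> \<le> total_variation \<mu> (\<Union>i\<in>I. B i)"
    unfolding total_variation_def using assms(1,3) disjoint_family_on_disjoint_image[OF assms(2)]
    by (intro SUP_upper) auto
  finally show ?thesis .
qed

text \<open>Every partition of \<open>B\<close> extends by the single part \<open>A\<close> to a
  partition of the union. This also yields monotonicity on Borel sets.\<close>

lemma total_variation_add_le:
  assumes \<mu>: "\<mu> {} = 0" and A: "A \<in> sets borel" and B: "B \<in> sets borel" "A \<inter> B = {}"
  shows "ennreal (cmod (\<mu> A)) + total_variation \<mu> B \<le> total_variation \<mu> (A \<union> B)"
proof -
  have "ennreal (cmod (\<mu> A)) + (\<Sum>C\<in>\<P>. ennreal (cmod (\<mu> C))) \<le> total_variation \<mu> (A \<union> B)"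
    if P: "finite \<P>" "disjoint \<P>" "\<P> \<subseteq> sets borel" "\<Union>\<P> = B" for \<P>
  proof -
    \<comment> \<open>Option indices keep \<open>A\<close> apart from the parts of \<open>B\<close>
      even when \<open>A\<close> is empty and also occurs among them.\<close>
    let ?D = "\<lambda>x. case x of None \<Rightarrow> A | Some C \<Rightarrow> C"
    have "(\<Sum>i\<in>insert None (Some ` \<P>). ennreal (cmod (\<mu> (?D i))))
        \<le> total_variation \<mu> (\<Union>i\<in>insert None (Some ` \<P>). ?D i)"
      using P A B(2) by (intro sum_le_total_variation \<mu>)
        (auto simp: disjoint_family_on_def disjoint_def)
    moreover have "(\<Union>i\<in>insert None (Some ` \<P>). ?D i) = A \<union> B" using P(4) by auto
    ultimately show ?thesis using P(1) by (simp add: sum.reindex sum_nonneg)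
  qed
  then show ?thesis
    unfolding total_variation_def[of \<mu> B]
    by (subst ennreal_SUP_add_right) (auto intro!: SUP_least exI[of _ "{B}"] B)
qed

lemma M0_bounded:
  assumes "\<mu> \<in> M0"
  obtains c where "\<And>B. B \<in> sets borel \<Longrightarrow> cmod (\<mu> B) \<le> c"
proof
  fix B :: "'a set" assume B: "B \<in> sets borel"
  have fin: "total_variation \<mu> UNIV < top" using assms by (simp add: M0_def)
  have "\<mu> {} = 0" using assms by (auto simp: M0_def complex_measure_iff intro: set_additive_empty)
  then have "ennreal (cmod (\<mu> B)) + total_variation \<mu> (- B) \<le> total_variation \<mu> (B \<union> - B)"
    using B by (intro total_variation_add_le) auto
  then have "ennreal (cmod (\<mu> B)) \<le> total_variation \<mu> UNIV"
    by (auto simp: Compl_partition intro: order_trans[rotated])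
  then show "cmod (\<mu> B) \<le> enn2real (total_variation \<mu> UNIV)"
    using fin by (metis enn2real_ennreal enn2real_mono norm_ge_zero)
qed

text \<open>Choose \<open>K\<close> carrying all but \<open>e\<close> of the total variation. For
  \<open>B\<close> disjoint from \<open>K\<close>, superadditivity leaves at most \<open>e\<close>
  for \<open>cmod (\<mu> B)\<close>. Having the bound for all such \<open>B\<close> makes it pass to
  the upper variations.\<close>

lemma M0_tight:
  assumes \<mu>: "\<mu> \<in> M0" and e: "e > 0"
  obtains K where "compact K" "\<And>B. B \<in> sets borel \<Longrightarrow> B \<subseteq> - K \<Longrightarrow> cmod (\<mu> B) \<le> e"
proof -
  have fin: "total_variation \<mu> UNIV < top" using \<mu> by (simp add: M0_def)
  have "total_variation \<mu> UNIV = (SUP K\<in>{K. compact K \<and> K \<subseteq> UNIV}. total_variation \<mu> K)"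
  proof -
    have "radon (total_variation \<mu>)" using \<mu> by (simp add: M0_def)
    then show ?thesis unfolding radon_def by (rule bspec) simp
  qed
  then obtain K where K: "compact K" "total_variation \<mu> UNIV < total_variation \<mu> K + ennreal e"
    using SUP_approx_ennreal[OF e _ _ less_imp_neq[OF fin, folded infinity_ennreal_def],
        of "{K. compact K \<and> K \<subseteq> UNIV}" "total_variation \<mu>"] by blast
  have \<mu>0: "\<mu> {} = 0" using \<mu> by (auto simp: M0_def complex_measure_iff intro: set_additive_empty)
  show thesis
  proof (rule that[OF K(1)])
    fix B assume B: "B \<in> sets borel" "B \<subseteq> - K"
    have mono: "total_variation \<mu> C \<le> total_variation \<mu> UNIV" if "C \<in> sets borel" for C
    proof -
      have "ennreal (cmod (\<mu> (- C))) + total_variation \<mu> C \<le> total_variation \<mu> (- C \<union> C)"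
        using that by (intro total_variation_add_le \<mu>0) auto
      then show ?thesis by (auto simp: Un_commute Compl_partition intro: order_trans[rotated])
    qed
    have "ennreal (cmod (\<mu> B)) + total_variation \<mu> K \<le> total_variation \<mu> (B \<union> K)"
      using B K(1) by (intro total_variation_add_le \<mu>0) (auto simp: compact_imp_closed)
    also have "\<dots> \<le> total_variation \<mu> UNIV" using B K(1) by (intro mono) (auto simp: compact_imp_closed)
    also have "\<dots> \<le> total_variation \<mu> K + ennreal e" using K(2) by simp
    finally have "ennreal (cmod (\<mu> B)) + total_variation \<mu> K \<le> ennreal e + total_variation \<mu> K"
      by (simp add: add.commute)
    moreover have "total_variation \<mu> K < top"
      using mono[of K] K(1) fin by (simp add: compact_imp_closed le_less_trans)
    ultimately show "cmod (\<mu> B) \<le> e"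
      using e by (auto simp: add.commute[of _ "total_variation \<mu> K"] ennreal_add_left_cancel_le)
  qed
qed

text \<open>Membership in \<open>M0\<close> by domination: regularity is inherited from finite tight
  measures. A finite family of dominating measures fits the four parts of a complex measure
  directly.\<close>

lemma M0I:
  fixes n :: "'i \<Rightarrow> 'a::metric_space measure"
  assumes J: "finite J" "\<And>j. j \<in> J \<Longrightarrow> finite_measure (n j)" "\<And>j. j \<in> J \<Longrightarrow> sets (n j) = sets borel"
    and tight: "\<And>j e. j \<in> J \<Longrightarrow> e > 0 \<Longrightarrow> \<exists>K. compact K \<and> measure (n j) (- K) < e"
    and \<mu>: "complex_measure \<mu>"
    and le: "\<And>A. A \<in> sets borel \<Longrightarrow> cmod (\<mu> A) \<le> (\<Sum>j\<in>J. measure (n j) A)"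
  shows "\<mu> \<in> M0"
proof -
  define s where "s A = (\<Sum>j\<in>J. measure (n j) A)" for A
  have \<mu>a: "set_additive \<mu>" using \<mu> by (simp add: complex_measure_iff)
  note \<mu>0 = set_additive_empty[OF \<mu>a]
  have s_sum: "(\<Sum>i\<in>I. ennreal (cmod (\<mu> (B i)))) \<le> ennreal (s (\<Union>i\<in>I. B i))"
    if I: "finite I" "disjoint_family_on B I" "\<And>i. i \<in> I \<Longrightarrow> B i \<in> sets borel"
    for B :: "'a set \<Rightarrow> 'a set" and I
  proof -
    have "(\<Sum>i\<in>I. cmod (\<mu> (B i))) \<le> (\<Sum>i\<in>I. s (B i))"
      unfolding s_def using I(3) by (intro sum_mono le)
    also have "\<dots> = (\<Sum>j\<in>J. \<Sum>i\<in>I. measure (n j) (B i))" unfolding s_def by (rule sum.swap)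
    also have "\<dots> = s (\<Union>i\<in>I. B i)"
      unfolding s_def using I J(2,3)
      by (intro sum.cong finite_measure.finite_measure_finite_Union[symmetric]) auto
    finally show ?thesis by (simp add: ennreal_leI)
  qed
  have "total_variation \<mu> UNIV \<le> ennreal (s UNIV)"
    unfolding total_variation_def
  proof (rule SUP_least, clarify)
    fix \<P> assume P: "finite \<P>" "disjoint \<P>" "\<P> \<subseteq> sets (borel :: 'a measure)" "\<Union>\<P> = UNIV"
    have "disjoint_family_on (\<lambda>B. B) \<P>"
      using P(2) by (simp add: disjoint_def disjoint_family_on_def)
    from s_sum[OF P(1) this] show "(\<Sum>B\<in>\<P>. ennreal (cmod (\<mu> B))) \<le> ennreal (s UNIV)"
      using P(3,4) by auto
  qed
  then have fin: "total_variation \<mu> UNIV < \<infinity>" by (simp add: le_less_trans)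
  have "total_variation \<mu> A = (SUP K\<in>{K. compact K \<and> K \<subseteq> A}. total_variation \<mu> K)"
    (is "_ = ?S") if A: "A \<in> sets borel" for A
  proof (rule antisym)
    show "?S \<le> total_variation \<mu> A"
    proof (rule SUP_least, clarify)
      fix K assume K: "compact K" "K \<subseteq> A"
      have "ennreal (cmod (\<mu> (A - K))) + total_variation \<mu> K \<le> total_variation \<mu> ((A - K) \<union> K)"
        using A K by (intro total_variation_add_le \<mu>0) (auto simp: compact_imp_closed)
      moreover have "(A - K) \<union> K = A" using K by auto
      ultimately have "ennreal (cmod (\<mu> (A - K))) + total_variation \<mu> K \<le> total_variation \<mu> A"
        by (simp only:)
      then show "total_variation \<mu> K \<le> total_variation \<mu> A"
        by (rule order_trans[rotated]) simp
    qed
    show "total_variation \<mu> A \<le> ?S"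
    proof (rule ennreal_le_epsilon)
      fix e :: real assume e: "e > 0"
      \<comment> \<open>Each \<open>n j\<close> may lose \<open>d\<close>; the added 1 keeps the
        denominator positive for empty \<open>J\<close>.\<close>
      define d where "d = e / (real (card J) + 1)"
      have d: "d > 0" using e by (simp add: d_def add_nonneg_pos)
      have "\<exists>K. compact K \<and> K \<subseteq> A \<and> measure (n j) (A - K) < d" if "j \<in> J" for j
        using tight_imp_compact_inner_regular[OF J(2,3)[OF that] tight[OF that] A d] .
      then obtain K where K: "\<And>j. j \<in> J \<Longrightarrow> compact (K j)" "\<And>j. j \<in> J \<Longrightarrow> K j \<subseteq> A"
        "\<And>j. j \<in> J \<Longrightarrow> measure (n j) (A - K j) < d" by metis
      define L where "L = (\<Union>j\<in>J. K j)"
      have L: "compact L" "L \<subseteq> A" using K(1,2) J(1) by (auto simp: L_def)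
      have mL: "L \<in> sets borel" using L(1) by (simp add: compact_imp_closed)
      have "s (A - L) \<le> (\<Sum>j\<in>J. d)"
        unfolding s_def
      proof (rule sum_mono)
        fix j assume j: "j \<in> J"
        interpret finite_measure "n j" using J(2)[OF j] .
        have "K j \<in> sets borel" using K(1)[OF j] by (simp add: compact_imp_closed)
        then have "measure (n j) (A - L) \<le> measure (n j) (A - K j)"
          using j A J(3)[OF j] by (intro finite_measure_mono) (auto simp: L_def)
        then show "measure (n j) (A - L) \<le> d" using K(3)[OF j] by linarith
      qed
      also have "\<dots> \<le> (real (card J) + 1) * d" using d by simp
      also have "\<dots> = e" by (simp add: d_def)
      finally have sL: "s (A - L) \<le> e" .
      show "total_variation \<mu> A \<le> ?S + ennreal e"
        unfolding total_variation_def[of \<mu> A]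
      proof (rule SUP_least, clarify)
        fix \<P> assume P: "finite \<P>" "disjoint \<P>" "\<P> \<subseteq> sets (borel :: 'a measure)" "A = \<Union>\<P>"
        have mb: "B \<in> sets borel" if "B \<in> \<P>" for B using P(3) that by auto
        have disj: "disjoint_family_on (\<lambda>B. B \<inter> L) \<P>" "disjoint_family_on (\<lambda>B. B - L) \<P>"
          using P(2) by (auto simp: disjoint_def disjoint_family_on_def)
        \<comment> \<open>Each part is cut along \<open>L\<close>. The inner pieces form a partition
          of \<open>L\<close>; the outer ones cost at most \<open>s (A - L)\<close>, hence at most
          \<open>e\<close>.\<close>
        have "ennreal (cmod (\<mu> B)) \<le> ennreal (cmod (\<mu> (B \<inter> L))) + ennreal (cmod (\<mu> (B - L)))"
          if "B \<in> \<P>" for B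
        proof -
          have "\<mu> B = \<mu> (B \<inter> L) + \<mu> (B - L)"
            using set_additive_Diff[OF \<mu>a, of B "B \<inter> L"] mb[OF that] mL by (simp add: Diff_Int)
          then have "cmod (\<mu> B) \<le> cmod (\<mu> (B \<inter> L)) + cmod (\<mu> (B - L))" by (simp add: norm_triangle_ineq)
          then show ?thesis by (simp add: ennreal_leI flip: ennreal_plus)
        qed
        then have "(\<Sum>B\<in>\<P>. ennreal (cmod (\<mu> B)))
            \<le> (\<Sum>B\<in>\<P>. ennreal (cmod (\<mu> (B \<inter> L)))) + (\<Sum>B\<in>\<P>. ennreal (cmod (\<mu> (B - L))))"
          unfolding sum.distrib[symmetric] by (rule sum_mono)
        also have "\<dots> \<le> total_variation \<mu> (\<Union>B\<in>\<P>. B \<inter> L) + ennreal (s (\<Union>B\<in>\<P>. B - L))"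
          using P(1) mb mL by (intro add_mono sum_le_total_variation s_sum disj \<mu>0) auto
        also have "(\<Union>B\<in>\<P>. B \<inter> L) = L" using L(2) P(4) by auto
        also have "(\<Union>B\<in>\<P>. B - L) = A - L" using P(4) by auto
        also have "total_variation \<mu> L + ennreal (s (A - L)) \<le> ?S + ennreal e"
          using L sL by (intro add_mono SUP_upper ennreal_leI) auto
        finally show "(\<Sum>B\<in>\<P>. ennreal (cmod (\<mu> B))) \<le> (SUP K\<in>{K. compact K \<and> K \<subseteq> \<Union>\<P>}. total_variation \<mu> K) + ennreal e"
          using P(4) by simp
      qed
    qed
  qed
  then show ?thesis using \<mu> fin by (auto simp: M0_def radon_def)
qed


section \<open>Weak continuity\<close>

context continuous_random_field
begin

section \<open>The transition kernel and its action on measures\<close>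

definition law :: "real \<Rightarrow> 'e \<Rightarrow> 'e measure" where
  "law t x = distr M borel (X t x)"

lemma sets_law [simp]: "sets (law t x) = sets borel"
  and space_law [simp]: "space (law t x) = UNIV"
  by (simp_all add: law_def)

lemma prob_space_law: "t \<ge> 0 \<Longrightarrow> prob_space (law t x)"
  unfolding law_def by (intro prob_space_distr X_measurable)

lemma emeasure_law:
  assumes "t \<ge> 0" "A \<in> sets borel"
  shows "emeasure (law t x) A = ennreal (prob {\<omega> \<in> space M. X t x \<omega> \<in> A})"
proof -
  have "X t x -` A \<inter> space M = {\<omega> \<in> space M. X t x \<omega> \<in> A}" by auto
  then show ?thesis
    using assms by (simp add: law_def emeasure_distr X_measurable emeasure_eq_measure)
qed

lemma integral_law:
  assumes "t \<ge> 0" "f \<in> Cb"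
  shows "(\<integral>y. f y \<partial>law t x) = T t f x"
  unfolding law_def transition_operator_def
  by (intro integral_distr X_measurable bcontfun_borel_measurable assms)

text \<open>Closed sets form an intersection-stable generator, and for closed \<open>A\<close> the
  probability of hitting \<open>A\<close> is a pointwise limit of functions continuous in
  \<open>x\<close>.\<close>

lemma law_measurable:
  assumes t: "t \<ge> 0"
  shows "law t \<in> borel \<rightarrow>\<^sub>M prob_algebra borel"
proof (rule measurable_prob_algebra_generated)
  show "sets borel = sigma_sets UNIV (Collect closed :: 'e set set)" by (simp add: borel_eq_closed)
  show "Int_stable (Collect closed :: 'e set set)" by (auto simp: Int_stable_def)
  fix A :: "'e set" assume "A \<in> Collect closed"
  then have A: "closed A" by simp
  have "(\<lambda>x. prob {\<omega> \<in> space M. X t x \<omega> \<in> A}) \<in> borel_measurable borel"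
  proof (cases "A = {}")
    case False
    \<comment> \<open>Continuous functions decreasing to the indicator of the closed set
      \<open>A\<close>. Nonemptiness matters: with \<open>infdist\<close> equal to 0 everywhere they
      would be constantly 1.\<close>
    define g where "g n y = max 0 (1 - real n * infdist y A)" for n and y :: 'e
    have gb: "g n \<in> bcontfun" for n
    proof -
      have "continuous_on UNIV (g n)" unfolding g_def by (intro continuous_intros)
      moreover have "bounded (range (g n))"
        by (rule boundedI[of _ 1]) (auto simp: g_def infdist_nonneg)
      ultimately show ?thesis by (simp add: bcontfun_def)
    qed
    show ?thesis
    proof (rule borel_measurable_LIMSEQ_real)
      fix n
      have "continuous_on UNIV ((\<lambda>(t, x). \<integral>\<omega>. g n (X t x \<omega>) \<partial>M) \<circ> (\<lambda>x. (t, x)))"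
        using t by (intro continuous_on_compose continuous_intros
            continuous_on_subset[OF continuous_on_expectation[OF gb]]) auto
      then show "(\<lambda>x. \<integral>\<omega>. g n (X t x \<omega>) \<partial>M) \<in> borel_measurable borel"
        by (intro borel_measurable_continuous_onI) (simp add: o_def)
    next
      fix x :: 'e
      note [measurable] = X_measurable[OF t] bcontfun_borel_measurable[OF gb]
      have [measurable]: "A \<in> sets borel" using A by simp
      have "(\<lambda>n. \<integral>\<omega>. g n (X t x \<omega>) \<partial>M) \<longlonglongrightarrow> (\<integral>\<omega>. indicator {\<omega> \<in> space M. X t x \<omega> \<in> A} \<omega> \<partial>M)"
      proof (rule integral_dominated_convergence[where w="\<lambda>_. 1"])
        show "AE \<omega> in M. (\<lambda>n. g n (X t x \<omega>)) \<longlonglongrightarrow> indicator {\<omega> \<in> space M. X t x \<omega> \<in> A} \<omega>"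
        proof (rule AE_I2)
          fix \<omega> assume w: "\<omega> \<in> space M"
          show "(\<lambda>n. g n (X t x \<omega>)) \<longlonglongrightarrow> indicator {\<omega> \<in> space M. X t x \<omega> \<in> A} \<omega>"
          proof (cases "X t x \<omega> \<in> A")
            case True
            then show ?thesis using w by (simp add: g_def)
          next
            case notin: False
            then have pos: "infdist (X t x \<omega>) A > 0"
              using in_closed_iff_infdist_zero[OF A False] infdist_nonneg[of "X t x \<omega>" A] by force
            obtain k :: nat where k: "1 / infdist (X t x \<omega>) A < real k"
              using reals_Archimedean2 by blast
            have "g n (X t x \<omega>) = 0" if "n \<ge> k" for n
            proof -
              have "1 < real k * infdist (X t x \<omega>) A" using k pos by (simp add: field_simps)
              also have "\<dots> \<le> real n * infdist (X t x \<omega>) A"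
                using that pos by (intro mult_right_mono) auto
              finally show ?thesis by (simp add: g_def)
            qed
            then have "(\<lambda>n. g n (X t x \<omega>)) \<longlonglongrightarrow> 0"
              by (intro tendsto_eventually) (auto simp: eventually_sequentially)
            then show ?thesis using notin by simp
          qed
        qed
        show "(\<lambda>\<omega>. g n (X t x \<omega>)) \<in> borel_measurable M" for n by measurable
      qed (auto simp: g_def infdist_nonneg)
      then show "(\<lambda>n. \<integral>\<omega>. g n (X t x \<omega>) \<partial>M) \<longlonglongrightarrow> prob {\<omega> \<in> space M. X t x \<omega> \<in> A}"
        by simp
    qed
  qed simp
  then show "(\<lambda>x. emeasure (law t x) A) \<in> borel_measurable borel"
    using A t by (simp add: emeasure_law)
qed (auto intro: prob_space_law[OF t])

text \<open>The adjoint of \<open>T t\<close> on positive measures: \<open>A\<close> receives the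
  integral of \<open>law t x A\<close> against \<open>m\<close>.\<close>

definition image_measure :: "real \<Rightarrow> 'e measure \<Rightarrow> 'e measure" where
  "image_measure t m = m \<bind> law t"

context
  fixes t :: real and m :: "'e measure"
  assumes t: "t \<ge> 0" and m: "finite_measure m" and sets_m: "sets m = sets borel"
begin

lemma law_measurable_subprob: "law t \<in> m \<rightarrow>\<^sub>M subprob_algebra borel"
  using measurable_prob_algebraD[OF law_measurable[OF t]]
  by (simp add: sets_m cong: measurable_cong_sets)

lemma space_m: "space m = UNIV"
  using sets_eq_imp_space_eq[OF sets_m] by simp

lemma sets_image_measure: "sets (image_measure t m) = sets borel"
  unfolding image_measure_def
  by (rule sets_bind_measurable[OF law_measurable_subprob]) (simp add: space_m)

lemma emeasure_image_measure:
  "A \<in> sets borel \<Longrightarrow> emeasure (image_measure t m) A = (\<integral>\<^sup>+x. emeasure (law t x) A \<partial>m)"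
  unfolding image_measure_def
  by (rule emeasure_bind[OF _ law_measurable_subprob]) (simp_all add: space_m)

lemma finite_measure_image_measure: "finite_measure (image_measure t m)"
proof
  have "emeasure (law t x) UNIV = 1" for x
    using prob_space.emeasure_space_1[OF prob_space_law[OF t, of x]] by simp
  then have "emeasure (image_measure t m) UNIV = emeasure m UNIV"
    using space_m by (simp add: emeasure_image_measure)
  then show "emeasure (image_measure t m) (space (image_measure t m)) \<noteq> \<infinity>"
    using sets_eq_imp_space_eq[OF sets_image_measure] finite_measure.finite_emeasure_space[OF m] space_m
    by simp
qed

text \<open>\<open>bind\<close> is the \<open>join\<close> of the distribution of
  \<open>law t\<close> under \<open>m\<close>, so this is iterated integration for
  \<open>join\<close>. The bound \<open>B'=1\<close> is the mass of the kernel measures.\<close>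

lemma integral_image_measure_real:
  fixes g :: "'e \<Rightarrow> real"
  assumes g: "g \<in> borel_measurable borel" "\<And>x. \<bar>g x\<bar> \<le> B"
  shows "(\<integral>y. g y \<partial>image_measure t m) = (\<integral>x. \<integral>y. g y \<partial>law t x \<partial>m)"
proof -
  let ?D = "distr m (subprob_algebra borel) (law t)"
  have "(\<integral>y. g y \<partial>join ?D) = (\<integral>N. integral\<^sup>L N g \<partial>?D)"
  proof (rule integral_join[where N=borel and B=B and B'=1])
    show "finite_measure ?D"
      by (intro finite_measure.finite_measure_distr m law_measurable_subprob)
    show "AE N in ?D. emeasure N (space N) \<le> ennreal 1"
      by (rule AE_I2) (auto simp: space_subprob_algebra subprob_space.emeasure_space_le_1)
  qed (use g in auto)
  also have "\<dots> = (\<integral>x. \<integral>y. g y \<partial>law t x \<partial>m)"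
    using g by (intro integral_distr[OF law_measurable_subprob] integral_measurable_subprob_algebra) auto
  finally show ?thesis
    unfolding image_measure_def
    by (subst bind_nonempty''[OF law_measurable_subprob]) (simp_all add: space_m)
qed

lemma integral_image_measure:
  assumes f: "f \<in> Cb"
  shows "(\<integral>y. f y \<partial>image_measure t m) = (\<integral>x. T t f x \<partial>m)"
proof -
  obtain B where B: "\<And>x. norm (f x) \<le> B" using bcontfun_normE[OF f] by blast
  note fm[measurable] = bcontfun_borel_measurable[OF f]
  have int: "integrable L h" if L: "finite_measure L" "sets L = sets borel" and h: "h \<in> Cb"
    for L and h :: "'e \<Rightarrow> complex"
  proof -
    interpret finite_measure L by fact
    obtain C where "\<And>x. norm (h x) \<le> C" using bcontfun_normE[OF h] by blast
    then show ?thesis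
      using bcontfun_borel_measurable[OF h] L(2)
      by (intro integrable_const_bound[of _ C]) (auto cong: measurable_cong_sets)
  qed
  have fin: "finite_measure (law t x)" for x using prob_space_law[OF t, of x] by (simp add: prob_space_def)
  note i1 = int[OF fin sets_law f] and i2 = int[OF finite_measure_image_measure sets_image_measure f]
    and i3 = int[OF m sets_m transition_operator_Cb[OF f t]]
  have bd: "\<bar>Re (f x)\<bar> \<le> B" "\<bar>Im (f x)\<bar> \<le> B" for x
    using B[of x] abs_Re_le_cmod[of "f x"] abs_Im_le_cmod[of "f x"] by linarith+
  have "(\<integral>y. Re (f y) \<partial>image_measure t m) = (\<integral>x. \<integral>y. Re (f y) \<partial>law t x \<partial>m)"
    "(\<integral>y. Im (f y) \<partial>image_measure t m) = (\<integral>x. \<integral>y. Im (f y) \<partial>law t x \<partial>m)"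
    using bd by (intro integral_image_measure_real[where B=B]; simp)+
  then show ?thesis
    using i1 i2 i3 by (simp add: complex_eq_iff integral_law[OF t f])
qed

text \<open>Mass leaves \<open>K\<close> either from starting points in \<open>L\<close>, where the
  laws are uniformly tight at the single time \<open>t\<close>, or from the small set
  \<open>- L\<close>.\<close>

lemma tight_image_measure:
  assumes tight: "\<And>e. e > 0 \<Longrightarrow> \<exists>K. compact K \<and> measure m (- K) \<le> e" and e: "e > 0"
  shows "\<exists>K. compact K \<and> measure (image_measure t m) (- K) < e"
proof -
  interpret m: finite_measure m by (rule m)
  interpret im: finite_measure "image_measure t m" by (rule finite_measure_image_measure)
  \<comment> \<open>The two contributions add up to at most
    \<open>d * (measure m UNIV + 1) = e / 2\<close>; the 1 also covers \<open>m\<close> of mass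
    0.\<close>
  define d where "d = e / (2 * (measure m UNIV + 1))"
  have c: "measure m UNIV + 1 > 0" by (simp add: add_nonneg_pos)
  have d: "d > 0" using e c by (simp add: d_def)
  obtain L where L: "compact L" "measure m (- L) \<le> d" using tight[OF d] by blast
  have sub: "{t} \<times> L \<subseteq> {0..} \<times> UNIV" using t by auto
  obtain K where K: "compact K" "\<And>s x. (s, x) \<in> {t} \<times> L \<Longrightarrow> prob {\<omega> \<in> space M. X s x \<omega> \<notin> K} \<le> d"
    using uniformly_tight[OF compact_Times[OF _ L(1)] sub d] by auto
  have mb: "- K \<in> sets borel" "- L \<in> sets borel" using K(1) L(1) by (auto simp: compact_imp_closed)
  have "emeasure (image_measure t m) (- K) = (\<integral>\<^sup>+x. emeasure (law t x) (- K) \<partial>m)"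
    by (rule emeasure_image_measure[OF mb(1)])
  also have "\<dots> \<le> (\<integral>\<^sup>+x. ennreal d + indicator (- L) x \<partial>m)"
  proof (rule nn_integral_mono)
    fix x
    show "emeasure (law t x) (- K) \<le> ennreal d + indicator (- L) x"
    proof (cases "x \<in> L")
      case True
      then show ?thesis using K(2)[of t x] by (simp add: emeasure_law[OF t mb(1)] ennreal_leI)
    next
      case False
      have "emeasure (law t x) (- K) \<le> 1"
        by (simp add: emeasure_law[OF t mb(1)])
      also have "\<dots> \<le> ennreal d + indicator (- L) x" using False by simp
      finally show ?thesis .
    qed
  qed
  also have "\<dots> = ennreal d * emeasure m UNIV + emeasure m (- L)"
    using mb(2) sets_m space_m by (subst nn_integral_add) auto
  also have "\<dots> = ennreal (d * measure m UNIV + measure m (- L))"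
    using d by (simp add: m.emeasure_eq_measure ennreal_mult ennreal_plus)
  finally have "measure (image_measure t m) (- K) \<le> d * measure m UNIV + measure m (- L)"
    using d by (simp add: im.emeasure_eq_measure del: ennreal_plus)
  also have "\<dots> \<le> d * (measure m UNIV + 1)" using L(2) by (simp add: distrib_left)
  also have "\<dots> = e / 2" using c by (simp add: d_def divide_simps)
  also have "\<dots> < e" using e by simp
  finally show ?thesis using K(1) by blast
qed

end

text \<open>The transpose of \<open>T t\<close> applies the transition kernel to each of the four Jordan parts of
  \<open>\<mu>\<close>. The result is Radon because a tight finite Borel measure on a metric space is Radon.\<close>

lemma transpose_exists:
  assumes t: "t \<ge> 0" and \<mu>: "\<mu> \<in> M0"
  shows "\<exists>\<nu>\<in>M0. \<forall>f\<in>Cb. pairing (T t f) \<mu> = pairing f \<nu>"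
proof -
  have \<mu>a: "set_additive \<mu>" using \<mu> by (simp add: M0_def complex_measure_iff)
  \<comment> \<open>Indexing the four signed parts lets finiteness, tightness and transport be
    proved once for all of them.\<close>
  define part where "part j = (\<lambda>A. [Re (\<mu> A), - Re (\<mu> A), Im (\<mu> A), - Im (\<mu> A)] ! j)" for j :: nat
  define m where "m j = upper_variation (part j)" for j
  define n where "n j = image_measure t (m j)" for j
  have part: "part 0 = (\<lambda>A. Re (\<mu> A))" "part 1 = (\<lambda>A. - Re (\<mu> A))" "part 2 = (\<lambda>A. Im (\<mu> A))"
    "part 3 = (\<lambda>A. - Im (\<mu> A))" by (auto simp: part_def eval_nat_numeral)
  have J: "{..<4} = {0, 1, 2, 3::nat}" by auto
  have part_add: "set_additive (part j)" if "j \<in> {..<4}" for j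
    using that set_additive_Re[OF \<mu>a] set_additive_Im[OF \<mu>a]
    unfolding J by (auto simp: part[unfolded One_nat_def] intro: set_additive_uminus)
  have part_le: "part j A \<le> cmod (\<mu> A)" if "j \<in> {..<4}" for j A
    using that abs_Re_le_cmod[of "\<mu> A"] abs_Im_le_cmod[of "\<mu> A"]
    unfolding J by (auto simp: part[unfolded One_nat_def])
  obtain c where c: "\<And>B. B \<in> sets borel \<Longrightarrow> cmod (\<mu> B) \<le> c" using M0_bounded[OF \<mu>] by blast
  have fin_m: "finite_measure (m j)" if "j \<in> {..<4}" for j
    unfolding m_def using part_le[OF that] c
    by (intro finite_measure_upper_variation[OF part_add[OF that], of c]) (meson order_trans)
  have sets_m: "sets (m j) = sets borel" for j by (simp add: m_def)
  have tight_m: "\<exists>K. compact K \<and> measure (m j) (- K) \<le> e" if j: "j \<in> {..<4}" and e: "e > 0" for j e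
  proof -
    obtain K where K: "compact K" "\<And>B. B \<in> sets borel \<Longrightarrow> B \<subseteq> - K \<Longrightarrow> cmod (\<mu> B) \<le> e"
      using M0_tight[OF \<mu> e] by blast
    have "emeasure (m j) (- K) \<le> ennreal e"
      unfolding m_def using K part_le[OF j]
      by (intro emeasure_upper_variation_le part_add[OF j])
        (auto simp: compact_imp_closed intro: order_trans)
    then have "measure (m j) (- K) \<le> e"
      using e by (simp add: finite_measure.emeasure_eq_measure[OF fin_m[OF j]])
    then show ?thesis using K(1) by blast
  qed
  note fin_n = finite_measure_image_measure[OF t fin_m sets_m, folded n_def]
  note sets_n = sets_image_measure[OF t fin_m sets_m, folded n_def]
  \<comment> \<open>The images \<open>n j\<close> may overlap, so they need not be the Jordan parts
    of \<open>\<nu>\<close>; they still compute its integrals and dominate it, as \<open>M0I\<close>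
    requires.\<close>
  define \<nu> where "\<nu> A = complex_of_real (measure (n 0) A - measure (n 1) A)
    + \<i> * complex_of_real (measure (n 2) A - measure (n 3) A)" for A
  have \<nu>a: "set_additive \<nu>"
    unfolding set_additive_def
  proof (intro allI impI)
    fix A :: "nat \<Rightarrow> 'e set" assume A: "range A \<subseteq> sets borel" "disjoint_family A"
    have "(\<lambda>i. measure (n j) (A i)) sums measure (n j) (\<Union>i. A i)" if "j \<in> {..<4}" for j
      using A sets_n[OF that] by (intro finite_measure.finite_measure_UNION fin_n that) auto
    then show "(\<lambda>i. \<nu> (A i)) sums \<nu> (\<Union>i. A i)"
      unfolding \<nu>_def by (intro sums_add sums_mult sums_of_real sums_diff) auto
  qed
  have "\<nu> \<in> M0"
  proof (rule M0I[where J="{..<4}" and n=n])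
    show "complex_measure \<nu>" using \<nu>a by (simp add: complex_measure_iff)
    show "\<exists>K. compact K \<and> measure (n j) (- K) < e" if "j \<in> {..<4}" "e > 0" for j e
      unfolding n_def using tight_m that by (intro tight_image_measure t fin_m sets_m) auto
    fix A :: "'e set"
    have "cmod (\<nu> A) \<le> \<bar>measure (n 0) A - measure (n 1) A\<bar> + \<bar>measure (n 2) A - measure (n 3) A\<bar>"
      unfolding \<nu>_def by (rule order_trans[OF norm_triangle_ineq]) (simp add: norm_mult del: of_real_diff)
    also have "\<dots> \<le> (measure (n 0) A + measure (n 1) A) + (measure (n 2) A + measure (n 3) A)"
      by (intro add_mono) (auto simp: abs_le_iff add_increasing add_increasing2)
    also have "\<dots> = (\<Sum>j<4. measure (n j) A)" unfolding J by simp
    finally show "cmod (\<nu> A) \<le> (\<Sum>j<4. measure (n j) A)" .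
  qed (use fin_n sets_n in auto)
  moreover have "pairing (T t f) \<mu> = pairing f \<nu>" if f: "f \<in> Cb" for f
  proof -
    have im: "(\<integral>x. f x \<partial>n j) = (\<integral>x. T t f x \<partial>m j)" if "j \<in> {..<4}" for j
      unfolding n_def by (rule integral_image_measure[OF t fin_m[OF that] sets_m f])
    have "signed_integral (\<lambda>A. Re (\<nu> A)) f = (\<integral>x. f x \<partial>n 0) - (\<integral>x. f x \<partial>n 1)"
      by (intro signed_integral_eq_diff fin_n sets_n set_additive_Re[OF \<nu>a] f) (auto simp: \<nu>_def)
    moreover have "signed_integral (\<lambda>A. Im (\<nu> A)) f = (\<integral>x. f x \<partial>n 2) - (\<integral>x. f x \<partial>n 3)"
      by (intro signed_integral_eq_diff fin_n sets_n set_additive_Im[OF \<nu>a] f) (auto simp: \<nu>_def)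
    ultimately show ?thesis
      unfolding pairing_def by (simp add: im signed_integral_def m_def part part[unfolded One_nat_def])
  qed
  ultimately show ?thesis by blast
qed

text \<open>The preimage of the subbasic set given by \<open>\<mu>\<close> is the subbasic set given
  by the transposed measure \<open>\<nu>\<close>, with the same \<open>U\<close>.\<close>

lemma weakly_continuous_transition:
  assumes t: "t \<ge> 0"
  shows "T t \<in> continuous_operators weak_topology"
proof -
  let ?G = "{{f \<in> Cb. pairing f \<mu> \<in> U} | \<mu> U. \<mu> \<in> M0 \<and> open U} :: ('e \<Rightarrow> complex) set set"
  have TC: "T t f \<in> Cb" if "f \<in> Cb" for f using transition_operator_Cb[OF that t] .
  have "\<Union>?G = Cb"
    using topspace_weak_topology unfolding weak_topology_def topology_generated_by_topspace .
  moreover have "openin weak_topology (T t -` V \<inter> Cb)" if G: "V \<in> ?G" for V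
  proof -
    obtain \<mu> U where V: "V = {f \<in> Cb. pairing f \<mu> \<in> U}" "\<mu> \<in> M0" "open U" using G by blast
    obtain \<nu> where \<nu>: "\<nu> \<in> M0" "\<And>f. f \<in> Cb \<Longrightarrow> pairing (T t f) \<mu> = pairing f \<nu>"
      using transpose_exists[OF t V(2)] by blast
    have "T t -` V \<inter> Cb = {f \<in> Cb. pairing f \<nu> \<in> U}" using TC \<nu>(2) by (auto simp: V(1))
    also have "openin weak_topology \<dots>"
      unfolding weak_topology_def using \<nu>(1) V(3) by (intro topology_generated_by_Basis) blast
    finally show ?thesis .
  qed
  ultimately have "continuous_map weak_topology (topology_generated_by ?G) (T t)"
    using TC by (intro continuous_on_generated_topo) auto
  then have "continuous_map weak_topology weak_topology (T t)" by (simp add: weak_topology_def)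
  then show ?thesis
    using TC linear_transition_operator[OF t] by (auto simp: continuous_operators_def)
qed

end

theorem theorem5p2:
  fixes M :: "'w measure" and X :: "real \<Rightarrow> 'e::complete_space \<Rightarrow> 'w \<Rightarrow> 'e"
  assumes "prob_space M"
    and "continuous_map (top_of_set ({0..} \<times> UNIV)) (L0_topology M) (\<lambda>(t, x). X t x)"
  defines "T \<equiv> transition_operator M X"
  shows "(\<forall>t0>0. {T t | t. 0 \<le> t \<and> t \<le> t0} \<subseteq> continuous_operators weak_topology \<and>
                 strict_equicontinuous {T t | t. 0 \<le> t \<and> t \<le> t0}) \<and>
         (operator_semigroup T \<longrightarrow>
            strict_continuous_family T \<and> quasi_strict_equicontinuous T)"
proof -
  interpret continuous_random_field M X
    using assms(1,2) by (simp add: continuous_random_field_def continuous_random_field_axioms_def)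
  show ?thesis
    unfolding T_def
    using weakly_continuous_transition strict_equicontinuous_locally strict_continuous_transition
      quasi_strict_equicontinuous_transition by blast
qed

end
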